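(* Let $H$ be a polyomino graph with a perfect matching, and let $K$ be a maximum resonant set of $H$. Then $H-K$ has a unique perfect matching.
   Context: A polyomino graph is a connected finite subgraph of the infinite plane square grid such that each interior (finite) face is bounded by a unit square and each edge belongs to at least one such square. For a plane bipartite graph $G$ with a perfect matching $M$, a cycle is $M$-alternating if its edges alternate between edges in $M$ and edges not in $M$; a finite face is $M$-resonant if its boundary is an $M$-alternating cycle. A set $\mathcal{H}$ of finite faces of $G$ is a resonant set if the faces in $\mathcal{H}$ are pairwise vertex-disjoint and there is a perfect matching $M$ of $G$ such that every face in $\mathcal{H}$ is $M$-resonant. A maximum resonant set is a resonant set of largest cardinality. For a set $K$ of faces, $G-K$ denotes the graph obtained from $G$ by deleting all vertices lying on the boundaries of faces in $K$ (the empty graph is considered to have exactly one perfect matching, the empty one). *)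

theory Defs
  imports "HOL-Analysis.Analysis"
begin

record 'a graph =
  verts :: "'a set"
  edges :: "'a set set"

definition subgraph :: "'a graph \<Rightarrow> 'a graph \<Rightarrow> bool" where
  "subgraph G G' \<longleftrightarrow>
     verts G \<subseteq> verts G' \<and> edges G \<subseteq> edges G' \<and> (\<forall>e \<in> edges G. e \<subseteq> verts G)"

definition connected_graph :: "'a graph \<Rightarrow> bool" where
  "connected_graph G \<longleftrightarrow>
     verts G \<noteq> {} \<and>
     (\<forall>u \<in> verts G. \<forall>v \<in> verts G. (u, v) \<in> {(x, y). {x, y} \<in> edges G}\<^sup>*)"

definition delete_verts :: "'a graph \<Rightarrow> 'a set \<Rightarrow> 'a graph" where
  "delete_verts G S = \<lparr>verts = verts G - S, edges = {e \<in> edges G. e \<inter> S = {}}\<rparr>"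

definition perfect_matching :: "'a graph \<Rightarrow> 'a set set \<Rightarrow> bool" where
  "perfect_matching G M \<longleftrightarrow>
     M \<subseteq> edges G \<and> (\<forall>v \<in> verts G. \<exists>!e. e \<in> M \<and> v \<in> e)"

text \<open>Cycles are given by the cyclic list of their vertices, the first vertex not being repeated.\<close>

definition cycle_edge :: "'a list \<Rightarrow> nat \<Rightarrow> 'a set" where
  "cycle_edge c i = {c ! (i mod length c), c ! (Suc i mod length c)}"

definition is_cycle :: "'a graph \<Rightarrow> 'a list \<Rightarrow> bool" where
  "is_cycle G c \<longleftrightarrow>
     3 \<le> length c \<and> distinct c \<and> set c \<subseteq> verts G \<and>
     (\<forall>i < length c. cycle_edge c i \<in> edges G)"

definition alternating_cycle :: "'a graph \<Rightarrow> 'a set set \<Rightarrow> 'a list \<Rightarrow> bool" where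
  "alternating_cycle G M c \<longleftrightarrow>
     is_cycle G c \<and>
     (\<forall>i < length c. cycle_edge c i \<in> M \<longleftrightarrow> cycle_edge c (Suc i) \<notin> M)"

text \<open>The infinite plane square grid, drawn in the complex plane with straight unit edges.\<close>

definition square_grid :: "(int \<times> int) graph" where
  "square_grid =
     \<lparr>verts = UNIV,
      edges = {{(a, b), (c, d)} | a b c d. \<bar>a - c\<bar> + \<bar>b - d\<bar> = 1}\<rparr>"

definition point :: "int \<times> int \<Rightarrow> complex" where
  "point v = Complex (of_int (fst v)) (of_int (snd v))"

definition edge_segment :: "(int \<times> int) set \<Rightarrow> complex set" where
  "edge_segment e = convex hull (point ` e)"

definition drawing :: "(int \<times> int) graph \<Rightarrow> complex set" where
  "drawing G = point ` verts G \<union> (\<Union>e \<in> edges G. edge_segment e)"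

definition finite_faces :: "(int \<times> int) graph \<Rightarrow> complex set set" where
  "finite_faces G = {f \<in> components (- drawing G). bounded f}"

definition face_verts :: "(int \<times> int) graph \<Rightarrow> complex set \<Rightarrow> (int \<times> int) set" where
  "face_verts G f = {v \<in> verts G. point v \<in> frontier f}"

definition unit_square :: "int \<Rightarrow> int \<Rightarrow> complex set" where
  "unit_square i j = cbox (point (i, j)) (point (i + 1, j + 1))"

definition polyomino :: "(int \<times> int) graph \<Rightarrow> bool" where
  "polyomino G \<longleftrightarrow>
     subgraph G square_grid \<and> finite (verts G) \<and> connected_graph G \<and>
     (\<forall>f \<in> finite_faces G. \<exists>i j. frontier f = frontier (unit_square i j)) \<and>
     (\<forall>e \<in> edges G. \<exists>f \<in> finite_faces G. edge_segment e \<subseteq> frontier f)"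

definition resonant_face ::
  "(int \<times> int) graph \<Rightarrow> (int \<times> int) set set \<Rightarrow> complex set \<Rightarrow> bool" where
  "resonant_face G M f \<longleftrightarrow>
     (\<exists>c. alternating_cycle G M c \<and>
          frontier f = (\<Union>i < length c. edge_segment (cycle_edge c i)))"

definition resonant_set :: "(int \<times> int) graph \<Rightarrow> complex set set \<Rightarrow> bool" where
  "resonant_set G K \<longleftrightarrow>
     K \<subseteq> finite_faces G \<and>
     pairwise (\<lambda>f g. disjnt (face_verts G f) (face_verts G g)) K \<and>
     (\<exists>M. perfect_matching G M \<and> (\<forall>f \<in> K. resonant_face G M f))"

text \<open>Comparing cardinalities with \<^const>\<open>card\<close> is sound here: in a polyomino every finite face
  is the interior of one of the finitely many unit squares with corners among the vertices,
  so resonant sets are finite.\<close>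

definition maximum_resonant_set :: "(int \<times> int) graph \<Rightarrow> complex set set \<Rightarrow> bool" where
  "maximum_resonant_set G K \<longleftrightarrow>
     resonant_set G K \<and> (\<forall>K'. resonant_set G K' \<longrightarrow> card K' \<le> card K)"

definition delete_faces :: "(int \<times> int) graph \<Rightarrow> complex set set \<Rightarrow> (int \<times> int) graph" where
  "delete_faces G K = delete_verts G (\<Union>f \<in> K. face_verts G f)"

end

theory Submission
  imports Defs
begin

text \<open>Suppose \<open>H - K\<close> has two perfect matchings and extend them to perfect matchings \<open>M\<close>, \<open>M'\<close> of \<open>H\<close>
  that agree at the vertices of \<open>K\<close>. Orienting edges from white to black, \<open>M' - M\<close> is a finite
  circulation, hence the coboundary of a finitely supported function \<open>w\<close> on unit squares. We may
  assume that the set \<open>R\<close> of squares with \<open>w \<ge> 1\<close> is nonempty; it consists of faces of \<open>H\<close>.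

  Let \<open>h\<close> be the height function of \<open>M\<close> on the faces. For every threshold \<open>\<tau>\<close>, flipping \<open>M\<close> along all
  squares of \<open>R\<close> with \<open>h < \<tau>\<close> gives a perfect matching. In it, all squares of \<open>R\<close> with \<open>h = \<tau>\<close> are
  resonant, and so is every \<open>k\<close> in \<open>K\<close>, except that for each \<open>k\<close> in \<open>K \<inter> R\<close> there are three consecutive
  thresholds to be avoided. Maximality of \<open>K\<close> for each \<open>\<tau>\<close>, summed over \<open>\<tau>\<close>, yields
  \<open>|R - K| \<le> 3 |K \<inter> R|\<close>. But the \<open>2 \<times> 2\<close> blocks of squares with lower left square in \<open>K \<inter> R\<close> are
  disjoint and lie in \<open>R\<close> without exhausting it, so \<open>|R| > 4 |K \<inter> R|\<close>, a contradiction.\<close>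

section \<open>Flipping squares below a height threshold\<close>

text \<open>Orients every edge from its even end to its odd end, which turns the indicator of a
  matching into a flow.\<close>

definition parity_sign :: "int \<Rightarrow> int \<Rightarrow> int" where
  "parity_sign i j = (if even (i + j) then 1 else -1)"

lemma parity_sign_shift [simp]:
  "parity_sign (i + 1) j = - parity_sign i j" "parity_sign i (j + 1) = - parity_sign i j"
  "parity_sign (i - 1) j = - parity_sign i j" "parity_sign i (j - 1) = - parity_sign i j"
  by (auto simp: parity_sign_def)

lemma parity_sign_cases: "parity_sign i j = 1 \<or> parity_sign i j = -1"
  by (auto simp: parity_sign_def)

text \<open>Unit squares are named by their lower left corners. A matching is given by the indicator \<open>x i j\<close>
  of the edge from \<open>(i, j)\<close> to \<open>(i + 1, j)\<close> and the indicator \<open>y i j\<close> of the edge from \<open>(i, j)\<close> to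
  \<open>(i, j + 1)\<close>.\<close>

definition alternating_square :: "(int \<Rightarrow> int \<Rightarrow> int) \<Rightarrow> (int \<Rightarrow> int \<Rightarrow> int) \<Rightarrow> int \<times> int \<Rightarrow> bool" where
  "alternating_square x y = (\<lambda>(i, j). x i (j + 1) = x i j \<and> y (i + 1) j = y i j \<and> x i j + y i j = 1)"

definition deg :: "(int \<Rightarrow> int \<Rightarrow> int) \<Rightarrow> (int \<Rightarrow> int \<Rightarrow> int) \<Rightarrow> int \<Rightarrow> int \<Rightarrow> int" where
  "deg x y i j = x i j + x (i - 1) j + y i j + y i (j - 1)"

text \<open>The integer form of vertex-disjointness of two unit squares, by
  \<open>corners_disjnt_iff\<close>.\<close>

definition apart :: "int \<times> int \<Rightarrow> int \<times> int \<Rightarrow> bool" where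
  "apart p q \<longleftrightarrow> \<bar>fst p - fst q\<bar> \<ge> 2 \<or> \<bar>snd p - snd q\<bar> \<ge> 2"

definition corners :: "int \<times> int \<Rightarrow> (int \<times> int) set" where
  "corners p = {fst p, fst p + 1} \<times> {snd p, snd p + 1}"

text \<open>The combinatorial core, free of graphs and topology: \<open>F\<close> stands for the
  face squares, \<open>x\<close>, \<open>y\<close> and \<open>x'\<close>, \<open>y'\<close> for the
  two matchings, \<open>w\<close> for the potential of their difference. With
  \<open>4 * x i j - 1\<close>, the four terms around a vertex of degree 1 add up to
  \<open>4 * 1 - 4 = 0\<close>, as a height function requires.\<close>

locale flip_setup =
  fixes F K :: "(int \<times> int) set" and x y x' y' w h :: "int \<Rightarrow> int \<Rightarrow> int"
  assumes x01: "x i j \<in> {0, 1}" and y01: "y i j \<in> {0, 1}"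
    and x'01: "x' i j \<in> {0, 1}" and y'01: "y' i j \<in> {0, 1}"
    and deg1: "p \<in> F \<Longrightarrow> (i, j) \<in> corners p \<Longrightarrow> deg x y i j = 1"
    and wx: "parity_sign i j * (x' i j - x i j) = w i j - w i (j - 1)"
    and wy: "parity_sign i j * (y' i j - y i j) = w (i - 1) j - w i j"
    and hx: "(i, j) \<in> F \<Longrightarrow> (i, j - 1) \<in> F \<Longrightarrow> parity_sign i j * (4 * x i j - 1) = h i j - h i (j - 1)"
    and hy: "(i, j) \<in> F \<Longrightarrow> (i - 1, j) \<in> F \<Longrightarrow> parity_sign i j * (4 * y i j - 1) = h (i - 1) j - h i j"
    and finF: "finite F"
    and KF: "K \<subseteq> F"
    and K_apart: "p \<in> K \<Longrightarrow> q \<in> K \<Longrightarrow> p \<noteq> q \<Longrightarrow> apart p q"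
    and K_alt: "p \<in> K \<Longrightarrow> alternating_square x y p"
    and w_block: "(i, j) \<in> K \<Longrightarrow> \<bar>a\<bar> \<le> 1 \<Longrightarrow> \<bar>b\<bar> \<le> 1 \<Longrightarrow> w (i + a) (j + b) = w i j"
    and wF: "w i j \<ge> 1 \<Longrightarrow> (i, j) \<in> F"
    and w_ne: "\<exists>i j. w i j \<ge> 1"
begin

definition region where "region = {(i, j). w i j \<ge> 1}"

definition flip :: "int \<Rightarrow> int \<Rightarrow> int \<Rightarrow> int" where
  "flip \<tau> i j = (if w i j \<ge> 1 \<and> h i j < \<tau> then 1 else 0)"

text \<open>Flipping adds the coboundary of \<open>flip \<tau>\<close>, so degrees are preserved and
  only the range \<open>{0, 1}\<close> needs care.\<close>

definition nx where "nx \<tau> i j = x i j + parity_sign i j * (flip \<tau> i j - flip \<tau> i (j - 1))"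
definition ny where "ny \<tau> i j = y i j + parity_sign i j * (flip \<tau> (i - 1) j - flip \<tau> i j)"

lemma finite_region: "finite region" and region_subset: "region \<subseteq> F"
proof -
  show "region \<subseteq> F" using wF by (auto simp: region_def)
  then show "finite region" using finF finite_subset by blast
qed

text \<open>Between two squares of the region, the parity and the sign of the height difference
  determine whether the edge is matched, so flipping only the lower square changes the indicator in
  the admissible direction. On the border of the region \<open>w\<close> jumps, so the two matchings
  differ at the edge and a flip replaces \<open>x\<close> by \<open>x'\<close>.\<close>

lemma nx01: "nx \<tau> i j \<in> {0, 1}"
proof (cases "w i j \<ge> 1 \<and> w i (j - 1) \<ge> 1")
  case True
  then have "parity_sign i j * (4 * x i j - 1) = h i j - h i (j - 1)" using hx wF by blast
  then show ?thesis using x01[of i j] parity_sign_cases[of i j] True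
    by (auto simp: nx_def flip_def)
next
  case False
  then show ?thesis using wx[of i j] x01[of i j] x'01[of i j] parity_sign_cases[of i j]
    by (auto simp: nx_def flip_def)
qed

lemma ny01: "ny \<tau> i j \<in> {0, 1}"
proof (cases "w i j \<ge> 1 \<and> w (i - 1) j \<ge> 1")
  case True
  then have "parity_sign i j * (4 * y i j - 1) = h (i - 1) j - h i j" using hy wF by blast
  then show ?thesis using y01[of i j] parity_sign_cases[of i j] True
    by (auto simp: ny_def flip_def)
next
  case False
  then show ?thesis using wy[of i j] y01[of i j] y'01[of i j] parity_sign_cases[of i j]
    by (auto simp: ny_def flip_def)
qed

lemma deg_n: "deg (nx \<tau>) (ny \<tau>) i j = deg x y i j"
  by (simp add: deg_def nx_def ny_def algebra_simps)

lemma nx_change: "nx \<tau> i j \<noteq> x i j \<Longrightarrow> (i, j) \<in> F \<or> (i, j - 1) \<in> F"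
  using wF by (auto simp: nx_def flip_def split: if_splits)

lemma ny_change: "ny \<tau> i j \<noteq> y i j \<Longrightarrow> (i, j) \<in> F \<or> (i - 1, j) \<in> F"
  using wF by (auto simp: ny_def flip_def split: if_splits)

text \<open>A square at the threshold height is a local minimum of the new height function.\<close>

lemma level_x:
  assumes "w i j \<ge> 1" "h i j = \<tau>"
  shows "nx \<tau> i j = (if parity_sign i j = 1 then 0 else 1)"
proof (cases "w i (j - 1) \<ge> 1")
  case True
  then have "parity_sign i j * (4 * x i j - 1) = h i j - h i (j - 1)" using hx wF assms by blast
  then show ?thesis using x01[of i j] parity_sign_cases[of i j] True assms
    by (auto simp: nx_def flip_def)
next
  case False
  then show ?thesis using wx[of i j] x01[of i j] x'01[of i j] parity_sign_cases[of i j] assms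
    by (auto simp: nx_def flip_def)
qed

lemma level_x':
  assumes "w i j \<ge> 1" "h i j = \<tau>"
  shows "nx \<tau> i (j + 1) = (if parity_sign i j = 1 then 0 else 1)"
proof (cases "w i (j + 1) \<ge> 1")
  case True
  then have "parity_sign i (j + 1) * (4 * x i (j + 1) - 1) = h i (j + 1) - h i j"
    using hx[of i "j + 1"] wF assms by auto
  then show ?thesis using x01[of i "j + 1"] parity_sign_cases[of i j] True assms
    by (auto simp: nx_def flip_def)
next
  case False
  then show ?thesis using wx[of i "j + 1"] x01[of i "j + 1"] x'01[of i "j + 1"] parity_sign_cases[of i j] assms
    by (auto simp: nx_def flip_def)
qed

lemma level_y:
  assumes "w i j \<ge> 1" "h i j = \<tau>"
  shows "ny \<tau> i j = (if parity_sign i j = 1 then 1 else 0)"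
proof (cases "w (i - 1) j \<ge> 1")
  case True
  then have "parity_sign i j * (4 * y i j - 1) = h (i - 1) j - h i j" using hy wF assms by blast
  then show ?thesis using y01[of i j] parity_sign_cases[of i j] True assms
    by (auto simp: ny_def flip_def)
next
  case False
  then show ?thesis using wy[of i j] y01[of i j] y'01[of i j] parity_sign_cases[of i j] assms
    by (auto simp: ny_def flip_def)
qed

lemma level_y':
  assumes "w i j \<ge> 1" "h i j = \<tau>"
  shows "ny \<tau> (i + 1) j = (if parity_sign i j = 1 then 1 else 0)"
proof (cases "w (i + 1) j \<ge> 1")
  case True
  then have "parity_sign (i + 1) j * (4 * y (i + 1) j - 1) = h i j - h (i + 1) j"
    using hy[of "i + 1" j] wF assms by auto
  then show ?thesis using y01[of "i + 1" j] parity_sign_cases[of i j] True assms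
    by (auto simp: ny_def flip_def)
next
  case False
  then show ?thesis using wy[of "i + 1" j] y01[of "i + 1" j] y'01[of "i + 1" j] parity_sign_cases[of i j] assms
    by (auto simp: ny_def flip_def)
qed

lemma level_alt:
  assumes "w i j \<ge> 1" "h i j = \<tau>"
  shows "alternating_square (nx \<tau>) (ny \<tau>) (i, j)"
  using level_x[OF assms] level_x'[OF assms] level_y[OF assms] level_y'[OF assms]
  by (simp add: alternating_square_def)

text \<open>For \<open>\<tau>\<close> in \<open>nbr_heights k\<close>, either some but not all neighbours of \<open>k\<close> get flipped, or a neighbour
  at height \<open>\<tau>\<close> competes with \<open>k\<close>.\<close>

definition nbr_heights :: "int \<times> int \<Rightarrow> int set" where
  "nbr_heights = (\<lambda>(i, j). let l = min (h (i - 1) j) (h i (j - 1)) in {l .. l + 2})"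

lemma K_nbrs:
  assumes "(i, j) \<in> K" "w i j \<ge> 1"
  shows "w (i - 1) j \<ge> 1" "w (i + 1) j \<ge> 1" "w i (j - 1) \<ge> 1" "w i (j + 1) \<ge> 1"
  using w_block[OF assms(1), of "-1" 0] w_block[OF assms(1), of 1 0]
    w_block[OF assms(1), of 0 "-1"] w_block[OF assms(1), of 0 1] assms(2) by auto

text \<open>Alternation makes the height steps to opposite neighbours equal: one pair lies at
  distance 1 from \<open>h i j\<close>, the other at distance 3 on the same side.\<close>

lemma K_nbr_heights:
  assumes "(i, j) \<in> K" "w i j \<ge> 1"
  shows "h (i + 1) j = h (i - 1) j" "h i (j + 1) = h i (j - 1)"
    "\<bar>h (i - 1) j - h i (j - 1)\<bar> = 2"
proof -
  note nb = K_nbrs[OF assms]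
  have "parity_sign i j * (4 * x i j - 1) = h i j - h i (j - 1)" using hx wF assms nb by blast
  moreover have "parity_sign i j * (4 * y i j - 1) = h (i - 1) j - h i j" using hy wF assms nb by blast
  moreover have "parity_sign i (j + 1) * (4 * x i (j + 1) - 1) = h i (j + 1) - h i j"
    using hx[of i "j + 1"] wF assms nb by auto
  moreover have "parity_sign (i + 1) j * (4 * y (i + 1) j - 1) = h i j - h (i + 1) j"
    using hy[of "i + 1" j] wF assms nb by auto
  moreover note K_alt[OF assms(1)] x01[of i j] y01[of i j] parity_sign_cases[of i j]
  ultimately show "h (i + 1) j = h (i - 1) j" "h i (j + 1) = h i (j - 1)"
    "\<bar>h (i - 1) j - h i (j - 1)\<bar> = 2"
    by (auto simp: alternating_square_def)
qed

text \<open>If the four neighbours share a flip value \<open>c\<close>, parallel sides change by the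
  same amount and \<open>x + y\<close> is preserved, so the square stays alternating whether or not
  it is flipped itself.\<close>

lemma K_alt_n:
  assumes k: "(i, j) \<in> K" and "w i j \<ge> 1 \<Longrightarrow> \<tau> \<notin> nbr_heights (i, j)"
  shows "alternating_square (nx \<tau>) (ny \<tau>) (i, j)"
proof -
  obtain c where c: "flip \<tau> (i - 1) j = c" "flip \<tau> (i + 1) j = c" "flip \<tau> i (j - 1) = c" "flip \<tau> i (j + 1) = c"
  proof (cases "w i j \<ge> 1")
    case True
    show ?thesis
      by (rule that[of "flip \<tau> (i - 1) j"])
        (use K_nbr_heights[OF k True] K_nbrs[OF k True] assms(2)[OF True] in
          \<open>auto simp: flip_def nbr_heights_def Let_def\<close>)
  next
    case False
    \<comment> \<open>By \<open>w_block\<close> no neighbour lies in the region either, so none is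
      flipped.\<close>
    then show ?thesis
      using that[of 0] w_block[OF k, of "-1" 0] w_block[OF k, of 1 0]
        w_block[OF k, of 0 "-1"] w_block[OF k, of 0 1] by (auto simp: flip_def)
  qed
  show ?thesis
    using K_alt[OF k] nx01[of \<tau> i j] ny01[of \<tau> i j] nx01[of \<tau> i "j + 1"] ny01[of \<tau> "i + 1" j]
      x01[of i j] y01[of i j] parity_sign_cases[of i j]
    by (auto simp: alternating_square_def nx_def ny_def c)
qed

section \<open>Resonant squares after the flip, and their disjointness\<close>

definition flippable where
  "flippable \<tau> = {(i, j) \<in> region - K. h i j = \<tau>} \<union> (K - {p \<in> K \<inter> region. \<tau> \<in> nbr_heights p})"

lemma flippable_F: "flippable \<tau> \<subseteq> F"
  using region_subset KF by (auto simp: flippable_def)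

lemma flippable_alt: "p \<in> flippable \<tau> \<Longrightarrow> alternating_square (nx \<tau>) (ny \<tau>) p"
  using level_alt K_alt_n by (cases p) (auto simp: flippable_def region_def)

lemma flippable_deg: "p \<in> flippable \<tau> \<Longrightarrow> (i, j) \<in> corners p \<Longrightarrow> deg (nx \<tau>) (ny \<tau>) i j = 1"
  using deg_n deg1[of p i j] flippable_F[of \<tau>] by auto

text \<open>Adjacent region squares have different heights since \<open>4 * y i j - 1\<close> is
  nonzero. If one of the two is in \<open>K\<close>, then \<open>w\<close> agrees on both, and the
  height of the other lies in \<open>nbr_heights\<close> of the first, which was therefore removed
  at this threshold.\<close>

lemma flippable_not_right: "(i, j) \<in> flippable \<tau> \<Longrightarrow> (i + 1, j) \<notin> flippable \<tau>"
proof
  assume a: "(i, j) \<in> flippable \<tau>" "(i + 1, j) \<in> flippable \<tau>"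
  have wk: "w (i + 1) j = w i j" if "(i, j) \<in> K \<or> (i + 1, j) \<in> K"
    using that w_block[of i j 1 0] w_block[of "i + 1" j "-1" 0] by auto
  have "\<not> ((i, j) \<in> K \<and> (i + 1, j) \<in> K)" using K_apart[of "(i,j)" "(i+1,j)"] by (auto simp: apart_def)
  moreover have "h i j \<noteq> h (i + 1) j" if "w i j \<ge> 1" "w (i + 1) j \<ge> 1"
    using hy[of "i + 1" j] wF[OF that(1)] wF[OF that(2)] y01[of "i + 1" j] parity_sign_cases[of i j] by auto
  moreover have "h (i + 1) j \<in> nbr_heights (i, j)" if "(i, j) \<in> K" "w i j \<ge> 1"
    using K_nbr_heights[OF that] by (auto simp: nbr_heights_def Let_def)
  moreover have "h i j \<in> nbr_heights (i + 1, j)" if "(i + 1, j) \<in> K" "w (i + 1) j \<ge> 1"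
    using K_nbr_heights[OF that] by (auto simp: nbr_heights_def Let_def)
  ultimately show False using a wk by (auto simp: flippable_def region_def)
qed

lemma flippable_not_up: "(i, j) \<in> flippable \<tau> \<Longrightarrow> (i, j + 1) \<notin> flippable \<tau>"
proof
  assume a: "(i, j) \<in> flippable \<tau>" "(i, j + 1) \<in> flippable \<tau>"
  have wk: "w i (j + 1) = w i j" if "(i, j) \<in> K \<or> (i, j + 1) \<in> K"
    using that w_block[of i j 0 1] w_block[of i "j + 1" 0 "-1"] by auto
  have "\<not> ((i, j) \<in> K \<and> (i, j + 1) \<in> K)" using K_apart[of "(i,j)" "(i,j + 1)"] by (auto simp: apart_def)
  moreover have "h i j \<noteq> h i (j + 1)" if "w i j \<ge> 1" "w i (j + 1) \<ge> 1"
    using hx[of i "j + 1"] wF[OF that(1)] wF[OF that(2)] x01[of i "j + 1"] parity_sign_cases[of i j] by auto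
  moreover have "h i (j + 1) \<in> nbr_heights (i, j)" if "(i, j) \<in> K" "w i j \<ge> 1"
    using K_nbr_heights[OF that] by (auto simp: nbr_heights_def Let_def)
  moreover have "h i j \<in> nbr_heights (i, j + 1)" if "(i, j + 1) \<in> K" "w i (j + 1) \<ge> 1"
    using K_nbr_heights[OF that] by (auto simp: nbr_heights_def Let_def)
  ultimately show False using a wk by (auto simp: flippable_def region_def)
qed

text \<open>Two alternating squares that meet in a single corner would give it two matched
  edges.\<close>

lemma flippable_not_diag: "(i, j) \<in> flippable \<tau> \<Longrightarrow> (i + 1, j + 1) \<notin> flippable \<tau>"
proof
  assume a: "(i, j) \<in> flippable \<tau>" "(i + 1, j + 1) \<in> flippable \<tau>"
  have "deg (nx \<tau>) (ny \<tau>) (i + 1) (j + 1) = 1"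
    using flippable_deg[OF a(1)] by (simp add: corners_def)
  then show False using flippable_alt[OF a(1)] flippable_alt[OF a(2)] by (simp add: alternating_square_def deg_def)
qed

lemma flippable_not_antidiag: "(i, j) \<in> flippable \<tau> \<Longrightarrow> (i + 1, j - 1) \<notin> flippable \<tau>"
proof
  assume a: "(i, j) \<in> flippable \<tau>" "(i + 1, j - 1) \<in> flippable \<tau>"
  have "deg (nx \<tau>) (ny \<tau>) (i + 1) j = 1"
    using flippable_deg[OF a(1)] by (simp add: corners_def)
  then show False using flippable_alt[OF a(1)] flippable_alt[OF a(2)] by (simp add: alternating_square_def deg_def)
qed

lemma flippable_apart: 
  assumes "p \<in> flippable \<tau>" "q \<in> flippable \<tau>" "p \<noteq> q"
  shows "apart p q"
proof (rule ccontr)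
  assume na: "\<not> apart p q"
  obtain i j i' j' where pq: "p = (i, j)" "q = (i', j')" by fastforce
  have 1: "i' = i \<or> i' = i + 1 \<or> i = i' + 1" "j' = j \<or> j' = j + 1 \<or> j = j' + 1"
    using na by (auto simp: apart_def pq)
  show False using 1 assms flippable_not_right[of i j] flippable_not_right[of i' j'] flippable_not_up[of i j] flippable_not_up[of i' j']
    flippable_not_diag[of i j] flippable_not_diag[of i' j'] flippable_not_antidiag[of i j] flippable_not_antidiag[of i' j']
    unfolding pq by (elim disjE) auto
qed

section \<open>Counting over all thresholds\<close>

lemma card_flippable: "card (flippable \<tau>) + card {p \<in> K \<inter> region. \<tau> \<in> nbr_heights p} = card {(i, j) \<in> region - K. h i j = \<tau>} + card K"
proof -
  have fin: "finite K" using KF finF finite_subset by blast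
  have "card (flippable \<tau>) = card {(i, j) \<in> region - K. h i j = \<tau>} + card (K - {p \<in> K \<inter> region. \<tau> \<in> nbr_heights p})"
    unfolding flippable_def
    by (rule card_Un_disjoint) (use fin finite_region in \<open>auto intro: finite_subset[of _ region]\<close>)
  moreover have "card (K - {p \<in> K \<inter> region. \<tau> \<in> nbr_heights p}) + card {p \<in> K \<inter> region. \<tau> \<in> nbr_heights p} = card K"
    using fin by (metis (no_types, lifting) card_Diff_subset card_mono finite_subset le_add_diff_inverse2 mem_Collect_eq IntE subsetI)
  ultimately show ?thesis by simp
qed

lemma card_region: "card region > 4 * card (K \<inter> region)"
proof -
  define g :: "(int \<times> int) \<times> (int \<times> int) \<Rightarrow> int \<times> int" where "g = (\<lambda>((i, j), (a, b)). (i + a, j + b))"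
  define D where "D = (K \<inter> region) \<times> ({0, 1::int} \<times> {0, 1::int})"
  have finK: "finite (K \<inter> region)" using finite_region by simp
  have inj: "inj_on g D"
  proof (rule inj_onI)
    fix u v assume a: "u \<in> D" "v \<in> D" "g u = g v"
    obtain i j a b i' j' a' b' where uv: "u = ((i, j), (a, b))" "v = ((i', j'), (a', b'))"
      by (metis prod.exhaust)
    have "(i, j) = (i', j')"
      using K_apart[of "(i, j)" "(i', j')"] a unfolding uv by (auto simp: D_def g_def apart_def)
    then show "u = v" using a unfolding uv g_def by auto
  qed
  have sub: "g ` D \<subseteq> region"
  proof
    fix p assume "p \<in> g ` D"
    then obtain i j a b where p: "p = (i + a, j + b)" "(i, j) \<in> K" "1 \<le> w i j" "a \<in> {0, 1}" "b \<in> {0, 1}"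
      by (auto simp: D_def g_def region_def)
    then show "p \<in> region" using w_block[of i j a b] by (auto simp: region_def)
  qed
  have "card (g ` D) = 4 * card (K \<inter> region)"
    using inj by (simp add: card_image D_def card_cartesian_product)
  moreover have "g ` D \<subset> region"
  proof (cases "K \<inter> region = {}")
    case True
    then show ?thesis using w_ne by (auto simp: D_def region_def)
  next
    case False
    \<comment> \<open>The left neighbour of a leftmost square of \<open>K \<inter> region\<close> is
      in the region by \<open>w_block\<close>, but in no block, since blocks extend only right and
      up. This makes the inequality strict.\<close>
    define m where "m = Min (fst ` (K \<inter> region))"
    have "m \<in> fst ` (K \<inter> region)" unfolding m_def using False finK by (intro Min_in) auto
    then obtain j where mj: "(m, j) \<in> K" "(m, j) \<in> region" by auto
    have min: "m \<le> i" if "(i, j) \<in> K \<inter> region" for i j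
      unfolding m_def by (rule Min_le) (use that finK in force)+
    have "(m - 1, j) \<in> region" using w_block[OF mj(1), of "-1" 0] mj(2) by (auto simp: region_def)
    moreover have "(m - 1, j) \<notin> g ` D" using min by (fastforce simp: D_def g_def)
    ultimately show ?thesis using sub by blast
  qed
  ultimately show ?thesis using psubset_card_mono[OF finite_region] by metis
qed

theorem larger_flippable_set: "\<exists>\<tau>. card (flippable \<tau>) > card K"
proof (rule ccontr)
  assume "\<not> ?thesis"
  then have le: "card {(i, j) \<in> region - K. h i j = \<tau>} \<le> card {p \<in> K \<inter> region. \<tau> \<in> nbr_heights p}" for \<tau>
    using card_flippable[of \<tau>] by (smt (verit) not_less nat_add_left_cancel_le add.commute add_le_cancel_right)
  define H where "H = (\<lambda>(i, j). h i j)"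
  \<comment> \<open>Thresholds from \<open>T\<close> suffice: they account for all of
    \<open>region - K\<close>, and they count each square of \<open>K \<inter> region\<close> at
    most three times.\<close>
  define T where "T = H ` (region - K)"
  have finT: "finite T" using finite_region by (simp add: T_def)
  have finK: "finite (K \<inter> region)" using finite_region by simp
  have "card (region - K) = (\<Sum>\<tau>\<in>T. card {p \<in> region - K. H p = \<tau>})"
    using sum.group[of "region - K" T H "\<lambda>_. 1::nat"] finite_region finT by (simp add: T_def)
  also have "\<dots> \<le> (\<Sum>\<tau>\<in>T. card {p \<in> K \<inter> region. \<tau> \<in> nbr_heights p})"
    by (rule sum_mono) (use le in \<open>auto simp: H_def case_prod_unfold\<close>)
  also have "\<dots> = (\<Sum>\<tau>\<in>T. \<Sum>p\<in>K \<inter> region. if \<tau> \<in> nbr_heights p then 1 else 0)"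
    using finK by (simp add: sum.If_cases Int_def conj_commute)
  also have "\<dots> = (\<Sum>p\<in>K \<inter> region. card (T \<inter> nbr_heights p))"
    using finT by (subst sum.swap) (simp add: sum.If_cases)
  also have "\<dots> \<le> (\<Sum>p\<in>K \<inter> region. 3)"
  proof (rule sum_mono)
    fix p
    obtain l where "nbr_heights p = {l .. l + 2}" by (cases p) (auto simp: nbr_heights_def Let_def)
    then show "card (T \<inter> nbr_heights p) \<le> 3" using card_mono[of "{l..l+2}" "T \<inter> {l..l+2}"] by simp
  qed
  finally have "card (region - K) \<le> 3 * card (K \<inter> region)" by simp
  moreover have "card region = card (region - K) + card (K \<inter> region)"
    using finite_region by (metis Int_commute add.commute card_Int_Diff)
  ultimately show False using card_region by linarith
qed

end

section \<open>Potentials of discrete flows\<close>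

text \<open>\<open>a i j\<close> is the flow along the edge from \<open>(i, j)\<close> to \<open>(i + 1, j)\<close>, and \<open>b i j\<close> the flow along
  the edge from \<open>(i, j)\<close> to \<open>(i, j + 1)\<close>.\<close>

definition divergence :: "(int \<Rightarrow> int \<Rightarrow> int) \<Rightarrow> (int \<Rightarrow> int \<Rightarrow> int) \<Rightarrow> int \<Rightarrow> int \<Rightarrow> int" where
  "divergence a b i j = a i j - a (i - 1) j + b i j - b i (j - 1)"

definition bounded_flow :: "(int \<Rightarrow> int \<Rightarrow> int) \<Rightarrow> int \<Rightarrow> bool" where
  "bounded_flow a L \<longleftrightarrow> (\<forall>i j. (\<bar>i\<bar> \<ge> L \<or> \<bar>j\<bar> \<ge> L) \<longrightarrow> a i j = 0)"

lemma bounded_flow_mono: "bounded_flow a L \<Longrightarrow> L \<le> L' \<Longrightarrow> bounded_flow a L'"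
  unfolding bounded_flow_def by (meson order.trans)

text \<open>The negated flow across the path of squares that enters row \<open>j\<close> from the
  left and ends at square \<open>(i, j)\<close>.\<close>

definition row_potential :: "int \<Rightarrow> (int \<Rightarrow> int \<Rightarrow> int) \<Rightarrow> int \<Rightarrow> int \<Rightarrow> int" where
  "row_potential L b i j = - (\<Sum>k\<in>{-L..i}. b k j)"

lemma row_potential_step:
  assumes "bounded_flow b L"
  shows "b i j = row_potential L b (i - 1) j - row_potential L b i j"
proof (cases "i \<ge> - L")
  case True
  then have "{-L..i} = insert i {-L..i - 1}" by auto
  then show ?thesis by (simp add: row_potential_def)
next
  case False
  then show ?thesis using assms by (simp add: row_potential_def bounded_flow_def)
qed

text \<open>Induction along the row. Only the divergence at vertices of row \<open>j\<close> up to
  column \<open>i\<close> enters; \<open>potential_on\<close> relies on this local form.\<close>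

lemma row_potential_vertical:
  assumes b: "bounded_flow b L" and a: "bounded_flow a L"
    and d: "\<And>k. k \<le> i \<Longrightarrow> divergence a b k j = 0"
  shows "a i j = row_potential L b i j - row_potential L b i (j - 1)"
  using d
proof (cases "i \<ge> - L")
  case False
  then show ?thesis using a by (simp add: row_potential_def bounded_flow_def)
next
  case True
  then show ?thesis using d
  proof (induction i rule: int_ge_induct)
    case base
    then show ?case using base(1)[of "-L"] a by (auto simp: row_potential_def bounded_flow_def divergence_def)
  next
    case (step i)
    have "divergence a b (i + 1) j = 0" using step by simp
    moreover have "a i j = row_potential L b i j - row_potential L b i (j - 1)"
      using step by simp
    ultimately show ?case
      using row_potential_step[OF b, of "i + 1" j] row_potential_step[OF b, of "i + 1" "j - 1"]
      by (simp add: divergence_def)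
  qed
qed

text \<open>The row potential vanishes in far rows because \<open>b\<close> does. In far columns
  \<open>a\<close> vanishes, so the potential is constant along the column and equals its value 0 in
  a far row.\<close>

lemma finite_potential:
  assumes b: "bounded_flow b L" and a: "bounded_flow a L" and d: "\<And>i j. divergence a b i j = 0"
  obtains u where "\<And>i j. a i j = u i j - u i (j - 1)" "\<And>i j. b i j = u (i - 1) j - u i j"
    "finite {(i, j). u i j \<noteq> 0}"
proof -
  define u where "u = row_potential L b"
  have h: "a i j = u i j - u i (j - 1)" for i j
    unfolding u_def by (rule row_potential_vertical[OF b a d])
  have v: "b i j = u (i - 1) j - u i j" for i j
    unfolding u_def by (rule row_potential_step[OF b])
  have zj: "u i j = 0" if "\<bar>j\<bar> \<ge> L" for i j
    using b that by (simp add: u_def row_potential_def bounded_flow_def)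
  have zi: "u i j = 0" if "\<bar>i\<bar> \<ge> L" for i j
  proof -
    have eq: "u i k = u i (k - 1)" for k
      using h[of i k] a that by (auto simp: bounded_flow_def)
    have "u i k = u i \<bar>L\<bar>" for k
    proof (induction k rule: int_induct[where k = "\<bar>L\<bar>"])
      case (step1 k)
      then show ?case using eq[of "k + 1"] by simp
    next
      case (step2 k)
      then show ?case using eq[of k] by simp
    qed simp
    then show ?thesis using zj[of "\<bar>L\<bar>"] by simp
  qed
  have "{(i, j). u i j \<noteq> 0} \<subseteq> {-L..L} \<times> {-L..L}"
  proof clarsimp
    fix i j assume "u i j \<noteq> 0"
    then have "\<not> \<bar>i\<bar> \<ge> L" "\<not> \<bar>j\<bar> \<ge> L" using zi zj by blast+
    then show "- L \<le> i \<and> i \<le> L \<and> - L \<le> j \<and> j \<le> L" by linarith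
  qed
  then have "finite {(i, j). u i j \<noteq> 0}" using finite_subset by blast
  with h v that show thesis by blast
qed

text \<open>Squares reachable from far away through side-adjacent squares outside \<open>F\<close>.
  The bound on \<open>j\<close> is strict so that all four corners of a starting square satisfy
  \<open>\<bar>j\<bar> \<ge> B\<close> or \<open>i \<ge> B\<close>. The left side is no starting
  region because row sums begin there.\<close>

inductive_set outer :: "(int \<times> int) set \<Rightarrow> int \<Rightarrow> (int \<times> int) set" for F B where
  far: "\<bar>j\<bar> > B \<or> i \<ge> B \<Longrightarrow> (i, j) \<in> outer F B"
| step: "(i, j) \<in> outer F B \<Longrightarrow> \<bar>i - i'\<bar> + \<bar>j - j'\<bar> = 1 \<Longrightarrow> (i', j') \<notin> F \<Longrightarrow> (i', j') \<in> outer F B"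

lemma finite_not_outer:
  assumes "F \<subseteq> {-B..B} \<times> {-B..B}"
  shows "finite (- outer F B)"
proof -
  \<comment> \<open>The columns on the left are reached by walking down and up from a far
    row.\<close>
  have left: "(i, j) \<in> outer F B" if "i < - B" for i j
  proof (induction j rule: int_induct[where k = "\<bar>B\<bar> + 1"])
    case base
    show ?case by (rule outer.far) auto
  next
    case (step1 k)
    show ?case by (rule outer.step[OF step1(2)]) (use assms that in auto)
  next
    case (step2 k)
    show ?case by (rule outer.step[OF step2(2)]) (use assms that in auto)
  qed
  have "- outer F B \<subseteq> {-B..B} \<times> {-B..B}"
  proof
    fix p assume p: "p \<in> - outer F B"
    obtain i j where ij: "p = (i, j)" by (cases p)
    have "\<not> (\<bar>j\<bar> > B \<or> i \<ge> B)" "\<not> i < - B" using p left outer.far[of B j i F] by (auto simp: ij)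
    then show "p \<in> {-B..B} \<times> {-B..B}" by (auto simp: ij)
  qed
  then show ?thesis using finite_subset by blast
qed

section \<open>Routing divergence out of a hole-free region\<close>

definition avoids :: "(int \<times> int) set \<Rightarrow> (int \<Rightarrow> int \<Rightarrow> int) \<Rightarrow> (int \<Rightarrow> int \<Rightarrow> int) \<Rightarrow> bool" where
  "avoids F a b \<longleftrightarrow> (\<forall>i j. (i, j) \<in> F \<longrightarrow> ((i, j - 1) \<in> F \<longrightarrow> a i j = 0) \<and> ((i - 1, j) \<in> F \<longrightarrow> b i j = 0))"

text \<open>A unit of divergence at a routable vertex can be moved to the region \<open>\<bar>j\<bar> \<ge> B \<or> i \<ge> B\<close>, which the
  row sums of \<open>row_potential\<close> never see, without touching edges interior to \<open>F\<close>.\<close>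

definition routable :: "(int \<times> int) set \<Rightarrow> int \<Rightarrow> int \<times> int \<Rightarrow> bool" where
  "routable F B v \<longleftrightarrow> (\<exists>a b L. bounded_flow a L \<and> bounded_flow b L \<and> avoids F a b \<and>
     (\<forall>i j. \<bar>j\<bar> < B \<and> i < B \<longrightarrow> divergence a b i j = of_bool ((i, j) = v)))"

lemma routable_far: "\<not> (\<bar>j\<bar> < B \<and> i < B) \<Longrightarrow> routable F B (i, j)"
  unfolding routable_def
  by (rule exI[of _ "\<lambda>_ _. 0"], rule exI[of _ "\<lambda>_ _. 0"], rule exI[of _ 0])
    (auto simp: bounded_flow_def avoids_def divergence_def)

lemma routable_add:
  assumes "routable F B v" "bounded_flow a' L'" "bounded_flow b' L'" "avoids F a' b'"
    "\<And>i j. divergence a' b' i j = of_bool ((i, j) = v') - of_bool ((i, j) = v)"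
  shows "routable F B v'"
proof -
  obtain a b L where *: "bounded_flow a L" "bounded_flow b L" "avoids F a b"
     "\<And>i j. \<bar>j\<bar> < B \<and> i < B \<Longrightarrow> divergence a b i j = of_bool ((i, j) = v)"
    using assms(1) unfolding routable_def by blast
  let ?a = "\<lambda>i j. a i j + a' i j" and ?b = "\<lambda>i j. b i j + b' i j"
  have "bounded_flow ?a (max L L')" "bounded_flow ?b (max L L')"
    using *(1,2) assms(2,3) by (auto simp: bounded_flow_def)
  moreover have "avoids F ?a ?b" using *(3) assms(4) by (auto simp: avoids_def)
  moreover have "divergence ?a ?b i j = divergence a b i j + divergence a' b' i j" for i j
    by (simp add: divergence_def)
  then have "divergence ?a ?b i j = of_bool ((i, j) = v')" if "\<bar>j\<bar> < B \<and> i < B" for i j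
    using *(4)[OF that] assms(5) by simp
  ultimately show ?thesis unfolding routable_def by blast
qed

text \<open>A unit of flow on the single edge shifts the divergence to its other end;
  \<open>avoids\<close> permits this once one side of the edge is outside \<open>F\<close>.\<close>

lemma routable_horizontal:
  assumes "(i, j) \<notin> F \<or> (i, j - 1) \<notin> F"
  shows "routable F B (i, j) \<longleftrightarrow> routable F B (i + 1, j)"
proof -
  define e :: "int \<Rightarrow> int \<Rightarrow> int \<Rightarrow> int" where "e c = (\<lambda>k l. c * of_bool (k = i \<and> l = j))" for c
  have bf: "bounded_flow (e c) (\<bar>i\<bar> + \<bar>j\<bar> + 1)" "bounded_flow (\<lambda>_ _. 0) (\<bar>i\<bar> + \<bar>j\<bar> + 1)" for c
    by (auto simp: bounded_flow_def e_def)
  have av: "avoids F (e c) (\<lambda>_ _. 0)" for c using assms by (auto simp: avoids_def e_def)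
  show ?thesis
    using routable_add[OF _ bf(1)[of "-1"] bf(2) av[of "-1"], of B "(i,j)" "(i+1,j)"]
      routable_add[OF _ bf(1)[of 1] bf(2) av[of 1], of B "(i+1,j)" "(i,j)"]
    by (auto simp add: divergence_def e_def of_bool_def algebra_simps)
qed

lemma routable_vertical:
  assumes "(i, j) \<notin> F \<or> (i - 1, j) \<notin> F"
  shows "routable F B (i, j) \<longleftrightarrow> routable F B (i, j + 1)"
proof -
  define e :: "int \<Rightarrow> int \<Rightarrow> int \<Rightarrow> int" where "e c = (\<lambda>k l. c * of_bool (k = i \<and> l = j))" for c
  have bf: "bounded_flow (e c) (\<bar>i\<bar> + \<bar>j\<bar> + 1)" "bounded_flow (\<lambda>_ _. 0) (\<bar>i\<bar> + \<bar>j\<bar> + 1)" for c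
    by (auto simp: bounded_flow_def e_def)
  have av: "avoids F (\<lambda>_ _. 0) (e c)" for c using assms by (auto simp: avoids_def e_def)
  show ?thesis
    using routable_add[OF _ bf(2) bf(1)[of "-1"] av[of "-1"], of B "(i,j)" "(i,j+1)"]
      routable_add[OF _ bf(2) bf(1)[of 1] av[of 1], of B "(i,j+1)" "(i,j)"]
    by (auto simp add: divergence_def e_def of_bool_def algebra_simps)
qed

lemma routable_square:
  assumes "(i, j) \<notin> F" "v \<in> corners (i, j)" "v' \<in> corners (i, j)" "routable F B v"
  shows "routable F B v'"
  using assms routable_horizontal[of i j F B] routable_horizontal[of i "j + 1" F B]
    routable_vertical[of i j F B] routable_vertical[of "i + 1" j F B]
  by (auto simp: corners_def)

text \<open>Side-adjacent squares share a corner, and routability passes between all corners of a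
  square outside \<open>F\<close>, so it spreads inward from the far region.\<close>

lemma outer_routable:
  assumes "(i, j) \<in> outer F B" "v \<in> corners (i, j)"
  shows "routable F B v"
  using assms
proof (induction arbitrary: v rule: outer.induct)
  case (far j i)
  then show ?case by (cases v) (auto simp: corners_def intro!: routable_far)
next
  case (step i j i' j')
  have "\<exists>v'. v' \<in> corners (i, j) \<and> v' \<in> corners (i', j')"
    using step(2) by (intro exI[of _ "(max i i', max j j')"]) (auto simp: corners_def)
  then obtain v' where "v' \<in> corners (i, j)" "v' \<in> corners (i', j')" by blast
  then show ?case using routable_square[of i' j' F v' v B] step by blast
qed

text \<open>A discrete Poincare lemma for a region without holes. The flow is cut off outside the
  interior edges of \<open>F\<close>; the divergence this creates is routed away without touching
  those edges, and \<open>row_potential\<close> then applies.\<close>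

lemma potential_on:
  assumes F: "F \<subseteq> {-B<..<B} \<times> {-B<..<B}" and out: "- F \<subseteq> outer F B"
    and d: "\<And>i j. \<lbrakk>(i, j) \<in> F; (i - 1, j) \<in> F; (i, j - 1) \<in> F; (i - 1, j - 1) \<in> F\<rbrakk> \<Longrightarrow> divergence a b i j = 0"
  obtains u where
    "\<And>i j. (i, j) \<in> F \<Longrightarrow> (i, j - 1) \<in> F \<Longrightarrow> a i j = u i j - u i (j - 1)"
    "\<And>i j. (i, j) \<in> F \<Longrightarrow> (i - 1, j) \<in> F \<Longrightarrow> b i j = u (i - 1) j - u i j"
proof -
  define a0 where "a0 i j = (if (i, j) \<in> F \<and> (i, j - 1) \<in> F then a i j else 0)" for i j
  define b0 where "b0 i j = (if (i, j) \<in> F \<and> (i - 1, j) \<in> F then b i j else 0)" for i j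
  have fin: "finite F" using F finite_subset by blast
  define U where "U = (\<Union>p\<in>F. corners p)"
  have finU: "finite U" using fin by (auto simp: U_def corners_def)
  have bf: "bounded_flow a0 B" "bounded_flow b0 B"
    using F by (fastforce simp: bounded_flow_def a0_def b0_def)+
  \<comment> \<open>All squares at a vertex that is not routable lie in \<open>F\<close>, so
    \<open>d\<close> applies: the cut-off creates divergence only at routable vertices.\<close>
  have dz: "divergence a0 b0 i j = 0" if "(i, j) \<notin> U \<or> \<not> routable F B (i, j)" for i j
  proof (cases "(i, j) \<in> U")
    case True
    then have nr: "\<not> routable F B (i, j)" using that by blast
    then have "p \<in> F" if "(i, j) \<in> corners p" for p
      using outer_routable[of "fst p" "snd p"] that out by auto
    then have "(i, j) \<in> F" "(i - 1, j) \<in> F" "(i, j - 1) \<in> F" "(i - 1, j - 1) \<in> F"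
      by (auto simp: corners_def)
    then show ?thesis using d[of i j] by (simp add: divergence_def a0_def b0_def)
  next
    case False
    then have "(i, j) \<notin> F" "(i - 1, j) \<notin> F" "(i, j - 1) \<notin> F" "(i - 1, j - 1) \<notin> F"
      by (force simp: U_def corners_def)+
    then show ?thesis by (simp add: divergence_def a0_def b0_def)
  qed
  define U' where "U' = {v \<in> U. routable F B v}"
  have finU': "finite U'" using finU by (simp add: U'_def)
  have "\<forall>v\<in>U'. \<exists>f g L. bounded_flow f L \<and> bounded_flow g L \<and> avoids F f g \<and>
     (\<forall>i j. \<bar>j\<bar> < B \<and> i < B \<longrightarrow> divergence f g i j = of_bool ((i, j) = v))"
    by (auto simp: U'_def routable_def)
  then obtain f g L where fgL: "\<And>v. v \<in> U' \<Longrightarrow> bounded_flow (f v) (L v)" "\<And>v. v \<in> U' \<Longrightarrow> bounded_flow (g v) (L v)"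
     "\<And>v. v \<in> U' \<Longrightarrow> avoids F (f v) (g v)" 
     "\<And>v i j. v \<in> U' \<Longrightarrow> \<bar>j\<bar> < B \<and> i < B \<Longrightarrow> divergence (f v) (g v) i j = of_bool ((i, j) = v)"
    by metis
  define c where "c v = divergence a0 b0 (fst v) (snd v)" for v
  \<comment> \<open>The routed flows cancel the divergence for \<open>\<bar>j\<bar> < B\<close> and
    \<open>i < B\<close>, and they vanish on the interior edges of \<open>F\<close>.\<close>
  define a1 where "a1 i j = a0 i j - (\<Sum>v\<in>U'. c v * f v i j)" for i j
  define b1 where "b1 i j = b0 i j - (\<Sum>v\<in>U'. c v * g v i j)" for i j
  obtain M where M: "\<forall>l \<in> insert B (L ` U'). l \<le> M"
    using finU' by (meson finite_imageI finite_insert finite_subset bdd_above_finite bdd_above_def)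
  have "bounded_flow (f v) M" "bounded_flow (g v) M" if "v \<in> U'" for v
    using fgL(1,2)[OF that] M that bounded_flow_mono by blast+
  moreover have "bounded_flow a0 M" "bounded_flow b0 M" using bf M bounded_flow_mono by blast+
  ultimately have bf1: "bounded_flow a1 M" "bounded_flow b1 M"
    by (auto simp: bounded_flow_def a1_def b1_def)
  have dz1: "divergence a1 b1 i j = 0" if "\<bar>j\<bar> < B \<and> i < B" for i j
  proof -
    have "divergence a1 b1 i j = divergence a0 b0 i j - (\<Sum>v\<in>U'. c v * divergence (f v) (g v) i j)"
      by (simp add: divergence_def a1_def b1_def sum_subtractf sum.distrib algebra_simps)
    also have "(\<Sum>v\<in>U'. c v * divergence (f v) (g v) i j) = (\<Sum>v\<in>U'. if (i, j) = v then c v else 0)"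
      using fgL(4) that by (intro sum.cong) auto
    also have "\<dots> = divergence a0 b0 i j"
      using dz[of i j] finU' by (auto simp: c_def U'_def)
    finally show ?thesis by simp
  qed
  let ?u = "row_potential M b1"
  show thesis
  proof (rule that[of ?u])
    fix i j assume *: "(i, j) \<in> F" "(i, j - 1) \<in> F"
    have "a1 i j = ?u i j - ?u i (j - 1)"
    proof (rule row_potential_vertical[OF bf1(2,1)])
      fix k assume "k \<le> i"
      moreover have "i < B" "- B < j" "j < B" using F *(1) by auto
      ultimately show "divergence a1 b1 k j = 0" using dz1[of j k] by simp
    qed
    moreover have "a1 i j = a i j" using fgL(3) * by (simp add: a1_def a0_def avoids_def)
    ultimately show "a i j = ?u i j - ?u i (j - 1)" by simp
  next
    fix i j assume *: "(i, j) \<in> F" "(i - 1, j) \<in> F"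
    have "b1 i j = b i j" using fgL(3) * by (simp add: b1_def b0_def avoids_def)
    then show "b i j = ?u (i - 1) j - ?u i j" using row_potential_step[OF bf1(2), of i j] by simp
  qed
qed

section \<open>Faces of polyomino graphs\<close>

definition cell :: "int \<times> int \<Rightarrow> complex set" where
  "cell p = box (point p) (point (fst p + 1, snd p + 1))"

definition hedge :: "int \<Rightarrow> int \<Rightarrow> (int \<times> int) set" where "hedge i j = {(i, j), (i + 1, j)}"
definition vedge :: "int \<Rightarrow> int \<Rightarrow> (int \<times> int) set" where "vedge i j = {(i, j), (i, j + 1)}"

lemma point_simps [simp]: "Re (point v) = of_int (fst v)" "Im (point v) = of_int (snd v)"
  by (simp_all add: point_def)

lemma mem_cell: "z \<in> cell (i, j) \<longleftrightarrow> of_int i < Re z \<and> Re z < of_int i + 1 \<and> of_int j < Im z \<and> Im z < of_int j + 1"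
  by (auto simp: cell_def in_box_complex_iff)

lemma mem_unit_square: "z \<in> unit_square i j \<longleftrightarrow> of_int i \<le> Re z \<and> Re z \<le> of_int i + 1 \<and> of_int j \<le> Im z \<and> Im z \<le> of_int j + 1"
  by (auto simp: unit_square_def in_cbox_complex_iff)

section \<open>Grid edges, segments and midpoints\<close>

lemma grid_edge_cases:
  assumes "e \<in> edges square_grid"
  obtains i j where "e = hedge i j" | i j where "e = vedge i j"
proof -
  obtain a b c d where e: "e = {(a, b), (c, d)}" "\<bar>a - c\<bar> + \<bar>b - d\<bar> = 1"
    using assms by (auto simp: square_grid_def)
  then consider "c = a + 1" "d = b" | "a = c + 1" "d = b" | "a = c" "d = b + 1" | "a = c" "b = d + 1"
    by linarith
  then show thesis
    by cases (use that e in \<open>auto simp: hedge_def vedge_def insert_commute\<close>)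
qed

lemma mem_hedge_segment:
  "z \<in> edge_segment (hedge i j) \<longleftrightarrow> of_int i \<le> Re z \<and> Re z \<le> of_int i + 1 \<and> Im z = of_int j"
proof -
  have "z \<in> edge_segment (hedge i j) \<longleftrightarrow> (\<exists>u. 0 \<le> u \<and> u \<le> 1 \<and> z = (1 - u) *\<^sub>R point (i, j) + u *\<^sub>R point (i + 1, j))"
    by (simp add: edge_segment_def hedge_def flip: segment_convex_hull) (simp add: in_segment)
  also have "\<dots> \<longleftrightarrow> (\<exists>u. 0 \<le> u \<and> u \<le> 1 \<and> Re z = of_int i + u \<and> Im z = of_int j)"
    by (auto simp: complex_eq_iff algebra_simps)
  also have "\<dots> \<longleftrightarrow> of_int i \<le> Re z \<and> Re z \<le> of_int i + 1 \<and> Im z = of_int j"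
    by (auto intro!: exI[of _ "Re z - of_int i"])
  finally show ?thesis .
qed

lemma mem_vedge_segment:
  "z \<in> edge_segment (vedge i j) \<longleftrightarrow> of_int j \<le> Im z \<and> Im z \<le> of_int j + 1 \<and> Re z = of_int i"
proof -
  have "z \<in> edge_segment (vedge i j) \<longleftrightarrow> (\<exists>u. 0 \<le> u \<and> u \<le> 1 \<and> z = (1 - u) *\<^sub>R point (i, j) + u *\<^sub>R point (i, j + 1))"
    by (simp add: edge_segment_def vedge_def flip: segment_convex_hull) (simp add: in_segment)
  also have "\<dots> \<longleftrightarrow> (\<exists>u. 0 \<le> u \<and> u \<le> 1 \<and> Im z = of_int j + u \<and> Re z = of_int i)"
    by (auto simp: complex_eq_iff algebra_simps)
  also have "\<dots> \<longleftrightarrow> of_int j \<le> Im z \<and> Im z \<le> of_int j + 1 \<and> Re z = of_int i"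
    by (auto intro!: exI[of _ "Im z - of_int j"])
  finally show ?thesis .
qed

lemma not_int_half: "(of_int a :: real) + 1 / 2 \<noteq> of_int b"
proof
  assume "(of_int a :: real) + 1 / 2 = of_int b"
  then have "of_int (2 * a + 1) = (of_int (2 * b) :: real)" by simp
  then have "2 * a + 1 = 2 * b" by linarith
  then show False by presburger
qed

lemma half_between_ints:
  assumes "(of_int a :: real) \<le> of_int i + 1 / 2" "(of_int i :: real) + 1 / 2 \<le> of_int a + 1"
  shows "a = i"
proof -
  have "(of_int a :: real) < of_int (i + 1)" "(of_int i :: real) < of_int (a + 1)" using assms by simp_all
  then show ?thesis unfolding of_int_less_iff by simp
qed

lemma not_strictly_between_ints: "\<not> ((of_int a :: real) < of_int b \<and> (of_int b :: real) < of_int a + 1)"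
proof -
  have "(of_int b :: real) < of_int a + 1 \<longleftrightarrow> b < a + 1"
    using of_int_less_iff[of b "a + 1", where ?'a = real] by simp
  then show ?thesis by auto
qed

text \<open>A midpoint lies on no other grid edge, so midpoints translate statements about point
  sets into membership of edges.\<close>

lemma hmid_segment:
  assumes "e \<in> edges square_grid" "Complex (of_int i + 1 / 2) (of_int j) \<in> edge_segment e"
  shows "e = hedge i j"
  using assms(1)
proof (cases rule: grid_edge_cases)
  case (1 a b)
  have "a = i" "b = j"
    using assms(2) half_between_ints[of a i] by (auto simp: 1 mem_hedge_segment)
  then show ?thesis using 1 by simp
next
  case (2 a b)
  then show ?thesis using assms(2) not_int_half by (simp add: mem_vedge_segment)
qed

lemma vmid_segment:
  assumes "e \<in> edges square_grid" "Complex (of_int i) (of_int j + 1 / 2) \<in> edge_segment e"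
  shows "e = vedge i j"
  using assms(1)
proof (cases rule: grid_edge_cases)
  case (2 a b)
  have "a = i" "b = j"
    using assms(2) half_between_ints[of b j] by (auto simp: 2 mem_vedge_segment)
  then show ?thesis using 2 by simp
next
  case (1 a b)
  then show ?thesis using assms(2) not_int_half by (simp add: mem_hedge_segment)
qed

lemma frontier_unit_square:
  "frontier (unit_square i j) = unit_square i j - cell (i, j)"
  by (simp add: unit_square_def cell_def frontier_cbox)

lemma frontier_cell:
  "frontier (cell (i, j)) = unit_square i j - cell (i, j)"
proof -
  have "cell (i, j) \<noteq> {}"
  proof -
    have "Complex (of_int i + 1/2) (of_int j + 1/2) \<in> cell (i, j)" by (simp add: mem_cell)
    then show ?thesis by blast
  qed
  then show ?thesis by (simp add: unit_square_def cell_def frontier_box)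
qed

lemma cell_frontier_union:
  "frontier (cell (i, j)) = edge_segment (hedge i j) \<union> edge_segment (vedge (i + 1) j) \<union>
     edge_segment (hedge i (j + 1)) \<union> edge_segment (vedge i j)"
  by (auto simp: frontier_cell mem_unit_square mem_cell mem_hedge_segment mem_vedge_segment)

text \<open>A connected set that meets \<open>f\<close> and misses its frontier lies in
  \<open>f\<close>. For the complement of the closed square this would contradict boundedness, so
  \<open>f\<close> lies inside the square; the open square then lies in \<open>f\<close>.\<close>

lemma face_eq_cell:
  assumes "f \<in> components (- S)" "closed S" "bounded f" "frontier f = frontier (unit_square i j)"
  shows "f = cell (i, j)"
proof -
  have conn: "connected f" and ne: "f \<noteq> {}" using in_components_connected[OF assms(1)] in_components_nonempty[OF assms(1)] by auto
  have op: "open f" using assms open_components[of "- S"] by blast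
  let ?Q = "unit_square i j"
  have Q: "convex ?Q" "bounded ?Q" "closed ?Q" by (auto simp: unit_square_def)
  have disj: "f \<inter> frontier ?Q = {}" using op assms(4) frontier_disjoint_eq[of f] by (simp add: Int_commute)
  have sub: "T \<subseteq> f" if "connected T" "T \<inter> frontier f = {}" "T \<inter> f \<noteq> {}" for T
    using connected_Int_frontier[OF that(1), of f] that by blast
  have fQ: "f \<subseteq> ?Q"
  proof (rule ccontr)
    assume "\<not> f \<subseteq> ?Q"
    then have "(- ?Q) \<inter> f \<noteq> {}" by blast
    moreover have "connected (- ?Q)" by (rule connected_complement_bounded_convex) (use Q in auto)
    moreover have "- ?Q \<inter> frontier f = {}" using assms(4) frontier_subset_closed[OF Q(3)] by auto
    ultimately have "- ?Q \<subseteq> f" using sub by blast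
    then have "bounded (- ?Q)" using assms(3) bounded_subset by blast
    then have "bounded (UNIV :: complex set)" using Q(2) by (metis Compl_partition bounded_Un)
    then show False by simp
  qed
  then have "f \<subseteq> cell (i, j)" using disj frontier_unit_square by blast
  moreover have "cell (i, j) \<subseteq> f"
  proof (rule sub)
    show "connected (cell (i, j))" by (auto simp: cell_def intro: convex_connected)
    show "cell (i, j) \<inter> frontier f = {}" using assms(4) by (auto simp: frontier_unit_square)
    show "cell (i, j) \<inter> f \<noteq> {}" using ne \<open>f \<subseteq> cell (i, j)\<close> by blast
  qed
  ultimately show ?thesis by blast
qed

lemma drawing_not_cell:
  assumes "subgraph G square_grid" "z \<in> drawing G"
  shows "z \<notin> cell (i, j)"
proof -
  note no = not_strictly_between_ints
  from assms(2) consider v where "z = point v" | e where "e \<in> edges G" "z \<in> edge_segment e"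
    by (auto simp: drawing_def)
  then show ?thesis
  proof cases
    case 1
    then show ?thesis using no by (auto simp: mem_cell)
  next
    case (2 e)
    then have "e \<in> edges square_grid" using assms by (auto simp: subgraph_def)
    then show ?thesis
      by (cases rule: grid_edge_cases) (use 2 no in \<open>auto simp: mem_cell mem_hedge_segment mem_vedge_segment\<close>)
  qed
qed

lemma finite_edges: "subgraph G square_grid \<Longrightarrow> finite (verts G) \<Longrightarrow> finite (edges G)"
  by (rule finite_subset[of _ "Pow (verts G)"]) (auto simp: subgraph_def)

lemma closed_drawing:
  assumes "subgraph G square_grid" "finite (verts G)"
  shows "closed (drawing G)"
proof -
  have "closed (edge_segment e)" if "e \<in> edges G" for e
  proof -
    have "finite e" using that assms finite_subset[of e "verts G"] by (auto simp: subgraph_def)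
    then show ?thesis unfolding edge_segment_def
      by (intro compact_imp_closed compact_convex_hull finite_imp_compact) auto
  qed
  then show ?thesis unfolding drawing_def using assms finite_edges[OF assms]
    by (intro closed_Un closed_UN finite_imp_closed) auto
qed

lemma eventually_floor_near:
  "\<forall>\<^sub>F y in nhds (x::real). of_int \<lfloor>y\<rfloor> \<le> x \<and> x \<le> of_int \<lfloor>y\<rfloor> + 1"
proof -
  have "\<forall>\<^sub>F y in nhds x. y \<in> {of_int \<lceil>x\<rceil> - 1 <..< of_int \<lfloor>x\<rfloor> + 1}"
    by (rule eventually_nhds_in_open) (auto, linarith+)
  then show ?thesis
  proof eventually_elim
    case (elim y)
    then have "\<lfloor>y\<rfloor> \<le> \<lfloor>x\<rfloor>" "\<lceil>x\<rceil> - 1 \<le> \<lfloor>y\<rfloor>"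
      using floor_less_iff[of y "\<lfloor>x\<rfloor> + 1"] le_floor_iff[of "\<lceil>x\<rceil> - 1" y] by auto
    then have "(of_int \<lfloor>y\<rfloor> :: real) \<le> of_int \<lfloor>x\<rfloor>" "(of_int \<lceil>x\<rceil> :: real) \<le> of_int (\<lfloor>y\<rfloor> + 1)"
      unfolding of_int_le_iff by auto
    then show ?case using of_int_floor_le[of x] le_of_int_ceiling[of x] unfolding of_int_add of_int_1 by linarith
  qed
qed

text \<open>Thus a neighbourhood of \<open>p\<close> is covered by closed unit squares that contain
  \<open>p\<close>.\<close>

lemma eventually_near_cell:
  "\<forall>\<^sub>F z in nhds p. p \<in> unit_square \<lfloor>Re z\<rfloor> \<lfloor>Im z\<rfloor>"
proof -
  have "\<forall>\<^sub>F z in nhds p. of_int \<lfloor>Re z\<rfloor> \<le> Re p \<and> Re p \<le> of_int \<lfloor>Re z\<rfloor> + 1"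
    by (rule eventually_compose_filterlim[OF eventually_floor_near]) (intro tendsto_intros filterlim_ident)
  moreover have "\<forall>\<^sub>F z in nhds p. of_int \<lfloor>Im z\<rfloor> \<le> Im p \<and> Im p \<le> of_int \<lfloor>Im z\<rfloor> + 1"
    by (rule eventually_compose_filterlim[OF eventually_floor_near]) (intro tendsto_intros filterlim_ident)
  ultimately show ?thesis by eventually_elim (simp add: mem_unit_square)
qed

locale polyomino_graph =
  fixes H :: "(int \<times> int) graph"
  assumes poly: "polyomino H"
begin

lemma sub: "subgraph H square_grid" and fin: "finite (verts H)"
  using poly by (auto simp: polyomino_def)

definition face_squares :: "(int \<times> int) set" where "face_squares = {p. cell p \<in> finite_faces H}"

lemma finite_face_cell: "f \<in> finite_faces H \<Longrightarrow> \<exists>p\<in>face_squares. f = cell p"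
proof -
  assume f: "f \<in> finite_faces H"
  then obtain i j where "frontier f = frontier (unit_square i j)" using poly by (auto simp: polyomino_def)
  then have "f = cell (i, j)"
    using f face_eq_cell[of f "drawing H"] closed_drawing[OF sub fin] by (auto simp: finite_faces_def)
  then show ?thesis using f by (auto simp: face_squares_def)
qed

lemma inj_cell: "cell p = cell q \<Longrightarrow> p = q"
proof -
  assume eq: "cell p = cell q"
  obtain i j k l where pq: "p = (i, j)" "q = (k, l)" by fastforce
  have "Complex (of_int i + 1/2) (of_int j + 1/2) \<in> cell p" by (simp add: mem_cell pq)
  then have "Complex (of_int i + 1/2) (of_int j + 1/2) \<in> cell q" using eq by simp
  then show ?thesis using half_between_ints[of k i] half_between_ints[of l j] by (auto simp: mem_cell pq)
qed

text \<open>The frontier of a face is drawn. The midpoint of each side is not a vertex, so it is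
  drawn by an edge, which must be that side.\<close>

lemma face_square_edges:
  assumes "(i, j) \<in> face_squares"
  shows "hedge i j \<in> edges H" "hedge i (j + 1) \<in> edges H" "vedge i j \<in> edges H" "vedge (i + 1) j \<in> edges H"
proof -
  have fr: "frontier (cell (i, j)) \<subseteq> drawing H"
    using assms frontier_of_components_closed_complement[OF closed_drawing[OF sub fin]]
    by (auto simp: face_squares_def finite_faces_def)
  have np: "z \<in> (\<Union>e \<in> edges H. edge_segment e)" if "z \<in> drawing H" "\<And>v. z \<noteq> point v" for z
    using that by (auto simp: drawing_def)
  have h: "hedge a b \<in> edges H" if m: "Complex (of_int a + 1/2) (of_int b) \<in> frontier (cell (i, j))" for a b
  proof -
    have "Complex (of_int a + 1/2) (of_int b) \<noteq> point v" for v
      using not_int_half by (auto simp: complex_eq_iff)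
    then obtain e where e: "e \<in> edges H" "Complex (of_int a + 1/2) (of_int b) \<in> edge_segment e"
      using np fr m by blast
    then have "e \<in> edges square_grid" using sub by (auto simp: subgraph_def)
    then show ?thesis using hmid_segment[OF _ e(2)] e(1) by simp
  qed
  have v: "vedge a b \<in> edges H" if m: "Complex (of_int a) (of_int b + 1/2) \<in> frontier (cell (i, j))" for a b
  proof -
    have "Complex (of_int a) (of_int b + 1/2) \<noteq> point v" for v
      using not_int_half by (auto simp: complex_eq_iff)
    then obtain e where e: "e \<in> edges H" "Complex (of_int a) (of_int b + 1/2) \<in> edge_segment e"
      using np fr m by blast
    then have "e \<in> edges square_grid" using sub by (auto simp: subgraph_def)
    then show ?thesis using vmid_segment[OF _ e(2)] e(1) by simp
  qed
  show "hedge i j \<in> edges H" "hedge i (j + 1) \<in> edges H" "vedge i j \<in> edges H" "vedge (i + 1) j \<in> edges H"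
    by (intro h v; simp add: frontier_cell mem_unit_square mem_cell)+
qed

text \<open>The frontier of the union of the closed squares of \<open>Q\<close> is drawn, so a face meeting that union
  stays inside it.\<close>

lemma enclosed_squares_are_faces:
  assumes "finite Q"
    and hb: "\<And>i j. ((i, j) \<in> Q) \<noteq> ((i, j - 1) \<in> Q) \<Longrightarrow> hedge i j \<in> edges H"
    and vb: "\<And>i j. ((i, j) \<in> Q) \<noteq> ((i - 1, j) \<in> Q) \<Longrightarrow> vedge i j \<in> edges H"
  shows "Q \<subseteq> face_squares"
proof
  fix q assume q: "q \<in> Q"
  obtain i j where ij: "q = (i, j)" by (cases q)
  define X where "X = (\<Union>(a, b)\<in>Q. unit_square a b)"
  have clX: "closed X" unfolding X_def using assms(1) by (intro closed_UN) (auto simp: unit_square_def)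
  have bdX: "bounded X" unfolding X_def using assms(1) by (intro bounded_UN) (auto simp: unit_square_def)
  \<comment> \<open>If exactly one of two neighbouring squares were in \<open>Q\<close>, their
    common side would be an edge and \<open>p\<close> would be drawn.\<close>
  have hor: "(a', b) \<in> Q" if p: "p \<notin> drawing H" "p \<in> unit_square a b" "p \<in> unit_square a' b" "(a, b) \<in> Q" for p a a' b
  proof (rule ccontr)
    assume n: "(a', b) \<notin> Q"
    consider "a' = a" | "a' = a + 1" | "a = a' + 1" using p by (auto simp: mem_unit_square) linarith
    then show False
    proof cases
      case 2
      then have "vedge a' b \<in> edges H" using vb[of a' b] n p by auto
      then show False using p 2 by (auto simp: drawing_def mem_vedge_segment mem_unit_square)
    next
      case 3
      then have "vedge a b \<in> edges H" using vb[of a b] n p by auto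
      then show False using p 3 by (auto simp: drawing_def mem_vedge_segment mem_unit_square)
    qed (use n p in auto)
  qed
  have ver: "(a, b') \<in> Q" if p: "p \<notin> drawing H" "p \<in> unit_square a b" "p \<in> unit_square a b'" "(a, b) \<in> Q" for p a b b'
  proof (rule ccontr)
    assume n: "(a, b') \<notin> Q"
    consider "b' = b" | "b' = b + 1" | "b = b' + 1" using p by (auto simp: mem_unit_square) linarith
    then show False
    proof cases
      case 2
      then have "hedge a b' \<in> edges H" using hb[of a b'] n p by auto
      then show False using p 2 by (auto simp: drawing_def mem_hedge_segment mem_unit_square)
    next
      case 3
      then have "hedge a b \<in> edges H" using hb[of a b] n p by auto
      then show False using p 3 by (auto simp: drawing_def mem_hedge_segment mem_unit_square)
    qed (use n p in auto)
  qed
  have all: "(a', b') \<in> Q" if p: "p \<notin> drawing H" "p \<in> unit_square a b" "p \<in> unit_square a' b'" "(a, b) \<in> Q" for p a b a' b'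
  proof -
    have "p \<in> unit_square a' b" using p by (simp add: mem_unit_square)
    then show ?thesis using hor[of p a b a'] ver[of p a' b b'] p by blast
  qed
  \<comment> \<open>Around an undrawn point of \<open>X\<close> all closed squares through it belong
    to \<open>Q\<close>, so the point is interior to \<open>X\<close>.\<close>
  have frX: "frontier X \<subseteq> drawing H"
  proof (rule ccontr)
    assume "\<not> ?thesis"
    then obtain p where p: "p \<in> frontier X" "p \<notin> drawing H" by blast
    then have "p \<in> X" using clX frontier_subset_closed by blast
    then obtain a b where ab: "(a, b) \<in> Q" "p \<in> unit_square a b" by (auto simp: X_def)
    have "\<forall>\<^sub>F z in nhds p. z \<in> X"
      using eventually_near_cell[of p]
    proof eventually_elim
      case (elim z)
      then have "(\<lfloor>Re z\<rfloor>, \<lfloor>Im z\<rfloor>) \<in> Q" using all p ab by blast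
      moreover have "z \<in> unit_square \<lfloor>Re z\<rfloor> \<lfloor>Im z\<rfloor>" by (auto simp: mem_unit_square)
      ultimately show ?case by (auto simp: X_def)
    qed
    then have "p \<in> interior X" by (auto simp: eventually_nhds interior_def)
    then show False using p by (simp add: frontier_def)
  qed
  define z where "z = Complex (of_int i + 1/2) (of_int j + 1/2)"
  have z: "z \<in> cell q" by (simp add: z_def mem_cell ij)
  then have nd: "z \<in> - drawing H" using drawing_not_cell[OF sub, of z i j] ij by blast
  define f where "f = connected_component_set (- drawing H) z"
  have f: "f \<in> components (- drawing H)" using nd by (auto simp: f_def components_def)
  have zf: "z \<in> f" using nd by (simp add: f_def)
  have "z \<in> X" using z q ij by (force simp: X_def mem_cell mem_unit_square)
  moreover have "connected f" by (simp add: f_def)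
  moreover have "f \<inter> frontier X = {}" using frX connected_component_subset[of "- drawing H" z] by (auto simp: f_def)
  ultimately have "f \<subseteq> X" using connected_Int_frontier[of f X] zf by blast
  then have "f \<in> finite_faces H" using f bdX bounded_subset by (auto simp: finite_faces_def)
  \<comment> \<open>The bounded face around the centre of \<open>q\<close> is a unit cell, and the
    centre identifies it as \<open>cell q\<close>.\<close>
  then obtain r where r: "r \<in> face_squares" "f = cell r" using finite_face_cell by blast
  have "r = q" using zf z unfolding r(2) using half_between_ints[of "fst r" i] half_between_ints[of "snd r" j] by (cases r) (auto simp: mem_cell ij z_def)
  then show "q \<in> face_squares" using r by simp
qed

end

section \<open>Matchings as indicator functions\<close>

lemma hedge_inject [simp]: "hedge i j = hedge k l \<longleftrightarrow> i = k \<and> j = l"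
  by (auto simp: hedge_def doubleton_eq_iff)

lemma vedge_inject [simp]: "vedge i j = vedge k l \<longleftrightarrow> i = k \<and> j = l"
  by (auto simp: vedge_def doubleton_eq_iff)

lemma hedge_neq_vedge [simp]: "hedge i j \<noteq> vedge k l" "vedge k l \<noteq> hedge i j"
  by (auto simp: hedge_def vedge_def doubleton_eq_iff)

lemma mem_hedge: "(a, b) \<in> hedge i j \<longleftrightarrow> b = j \<and> (i = a \<or> i = a - 1)"
  by (auto simp: hedge_def)

lemma mem_vedge: "(a, b) \<in> vedge i j \<longleftrightarrow> a = i \<and> (j = b \<or> j = b - 1)"
  by (auto simp: vedge_def)

lemma grid_edge_at:
  assumes "e \<in> edges square_grid"
  shows "(i, j) \<in> e \<longleftrightarrow> e \<in> {hedge i j, hedge (i - 1) j, vedge i j, vedge i (j - 1)}"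
  using assms by (cases rule: grid_edge_cases) (auto simp: mem_hedge mem_vedge)

definition hmatch :: "(int \<times> int) set set \<Rightarrow> int \<Rightarrow> int \<Rightarrow> int" where "hmatch M i j = of_bool (hedge i j \<in> M)"
definition vmatch :: "(int \<times> int) set set \<Rightarrow> int \<Rightarrow> int \<Rightarrow> int" where "vmatch M i j = of_bool (vedge i j \<in> M)"

lemma deg_eq_1_iff:
  assumes "M \<subseteq> edges square_grid"
  shows "deg (hmatch M) (vmatch M) i j = 1 \<longleftrightarrow> (\<exists>!e. e \<in> M \<and> (i, j) \<in> e)"
proof -
  have "e \<in> M \<and> (i, j) \<in> e \<longleftrightarrow> e \<in> M \<and> e \<in> {hedge i j, hedge (i - 1) j, vedge i j, vedge i (j - 1)}" for e
    using assms grid_edge_at by blast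
  then have "(\<exists>!e. e \<in> M \<and> (i, j) \<in> e) \<longleftrightarrow> (\<exists>!e. e \<in> M \<and> e \<in> {hedge i j, hedge (i - 1) j, vedge i j, vedge i (j - 1)})"
    by simp
  also have "\<dots> \<longleftrightarrow> deg (hmatch M) (vmatch M) i j = 1"
    by (auto simp: deg_def hmatch_def vmatch_def of_bool_def Ex1_def)
  finally show ?thesis by simp
qed

lemma corners_disjnt_iff: "disjnt (corners p) (corners q) \<longleftrightarrow> apart p q"
proof -
  have "disjnt {a, a + 1} {b, b + 1} \<longleftrightarrow> \<bar>a - b\<bar> \<ge> 2" for a b :: int
    by (auto simp: disjnt_def)
  then show ?thesis unfolding corners_def apart_def disjnt_def Times_Int_Times Times_empty by metis
qed

text \<open>The minus signs of incoming edges cancel against the opposite parity of the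
  neighbours.\<close>

lemma divergence_parity_sign:
  "divergence (\<lambda>i j. parity_sign i j * x i j) (\<lambda>i j. parity_sign i j * y i j) i j = parity_sign i j * deg x y i j"
  by (simp add: divergence_def deg_def algebra_simps)

text \<open>Resonance only says that some alternating cycle covers the frontier as a point set. Its
  vertices are among four corners and its edges include four different sides, so it has length 4 and
  runs around the square.\<close>

lemma alternating_square_cycle:
  assumes "alternating_cycle H M c" "subgraph H square_grid"
    and "frontier (cell (i, j)) = (\<Union>k < length c. edge_segment (cycle_edge c k))"
  shows "alternating_square (hmatch M) (vmatch M) (i, j)"
proof -
  let ?E = "{hedge i j, vedge (i + 1) j, hedge i (j + 1), vedge i j}"
  have c: "3 \<le> length c" "distinct c" and ce: "\<And>k. k < length c \<Longrightarrow> cycle_edge c k \<in> edges square_grid"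
    and alt: "\<And>k. k < length c \<Longrightarrow> cycle_edge c k \<in> M \<longleftrightarrow> cycle_edge c (Suc k) \<notin> M"
    using assms(1,2) by (auto simp: alternating_cycle_def is_cycle_def subgraph_def)
  have E: "\<exists>k<length c. e = cycle_edge c k" if e: "e \<in> ?E" for e
  proof -
    consider a b where "e = hedge a b" "Complex (of_int a + 1 / 2) (of_int b) \<in> frontier (cell (i, j))"
      | a b where "e = vedge a b" "Complex (of_int a) (of_int b + 1 / 2) \<in> frontier (cell (i, j))"
    proof -
      assume h: "\<And>a b. e = hedge a b \<Longrightarrow> Complex (of_int a + 1 / 2) (of_int b) \<in> frontier (cell (i, j)) \<Longrightarrow> thesis"
        and v: "\<And>a b. e = vedge a b \<Longrightarrow> Complex (of_int a) (of_int b + 1 / 2) \<in> frontier (cell (i, j)) \<Longrightarrow> thesis"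
      show thesis
        using e h[of i j] h[of i "j + 1"] v[of i j] v[of "i + 1" j]
        by (auto simp: frontier_cell mem_unit_square mem_cell)
    qed
    then show ?thesis
    proof cases
      case 1
      then obtain k where "k < length c" "Complex (of_int a + 1 / 2) (of_int b) \<in> edge_segment (cycle_edge c k)"
        using assms(3) by blast
      then show ?thesis using hmid_segment[OF ce] 1 by blast
    next
      case 2
      then obtain k where "k < length c" "Complex (of_int a) (of_int b + 1 / 2) \<in> edge_segment (cycle_edge c k)"
        using assms(3) by blast
      then show ?thesis using vmid_segment[OF ce] 2 by blast
    qed
  qed
  have "set c \<subseteq> corners (i, j)"
  proof
    fix v assume "v \<in> set c"
    then obtain k where k: "k < length c" "v = c ! k" by (metis in_set_conv_nth)
    then have "v \<in> cycle_edge c k" by (simp add: cycle_edge_def)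
    then have "point v \<in> edge_segment (cycle_edge c k)" unfolding edge_segment_def by (intro hull_inc) auto
    then have "point v \<in> frontier (cell (i, j))" using assms(3) k by blast
    then show "v \<in> corners (i, j)"
      by (cases v) (auto simp: frontier_cell mem_unit_square mem_cell corners_def)
  qed
  then have "length c \<le> card (corners (i, j))"
    using c(2) by (metis card_mono corners_def distinct_card finite.emptyI finite.insertI finite_cartesian_product)
  also have "\<dots> = 4" by (simp add: corners_def)
  finally have len: "length c = 3 \<or> length c = 4" using c(1) by linarith
  have "?E \<subseteq> cycle_edge c ` {..<length c}" using E by blast
  then have "card ?E \<le> length c" by (metis card_lessThan finite_lessThan surj_card_le)
  moreover have "card ?E = 4" by simp
  ultimately have l4: "length c = 4" using len by simp
  have ex: "(\<exists>k<(4::nat). P k) \<longleftrightarrow> P 0 \<or> P 1 \<or> P 2 \<or> P 3" for P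
    by (auto simp: numeral_eq_Suc less_Suc_eq)
  obtain p0 p1 p2 p3 where p: "c = [p0, p1, p2, p3]"
    using l4 by (auto simp: numeral_eq_Suc length_Suc_conv)
  have cy: "cycle_edge c 0 = {p0, p1}" "cycle_edge c 1 = {p1, p2}" "cycle_edge c 2 = {p2, p3}" "cycle_edge c 3 = {p3, p0}"
    "cycle_edge c 4 = {p0, p1}"
    by (simp_all add: p cycle_edge_def)
  have al: "{p0, p1} \<in> M \<longleftrightarrow> {p1, p2} \<notin> M" "{p1, p2} \<in> M \<longleftrightarrow> {p2, p3} \<notin> M" "{p2, p3} \<in> M \<longleftrightarrow> {p3, p0} \<notin> M"
    using alt[of 0] alt[of 1] alt[of 2] l4 cy by (simp_all add: numeral_eq_Suc)
  have e: "e \<in> {{p0, p1}, {p1, p2}, {p2, p3}, {p3, p0}}" if "e \<in> ?E" for e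
    using E[OF that] unfolding l4 ex cy by blast
  \<comment> \<open>Opposite edges of the 4-cycle are disjoint, so two different sides that meet are
    consecutive and alternate.\<close>
  have opp: "{p0, p1} \<inter> {p2, p3} = {}" "{p1, p2} \<inter> {p3, p0} = {}"
    using c(2) by (auto simp: p)
  have alt_adj: "e \<in> M \<longleftrightarrow> e' \<notin> M" if "e \<in> ?E" "e' \<in> ?E" "e \<noteq> e'" "e \<inter> e' \<noteq> {}" for e e'
    using e[OF that(1)] e[OF that(2)] that(3,4) opp al by (elim insertE emptyE) auto
  have "hedge i j \<in> M \<longleftrightarrow> vedge i j \<notin> M" "hedge i j \<in> M \<longleftrightarrow> vedge (i + 1) j \<notin> M"
    "hedge i (j + 1) \<in> M \<longleftrightarrow> vedge i j \<notin> M"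
    by (rule alt_adj; auto simp: hedge_def vedge_def doubleton_eq_iff)+
  then show ?thesis by (auto simp: alternating_square_def hmatch_def vmatch_def)
qed

text \<open>Two parallel matched sides already cover all four corners.\<close>

lemma alternating_edges_in_corners:
  assumes M: "M \<subseteq> edges square_grid" and alt: "alternating_square (hmatch M) (vmatch M) p"
    and "\<And>v. v \<in> corners p \<Longrightarrow> \<exists>!e. e \<in> M \<and> v \<in> e" and e: "e \<in> M" "v \<in> e" "v \<in> corners p"
  shows "e \<subseteq> corners p"
proof -
  obtain i j where p: "p = (i, j)" by (cases p)
  have "\<exists>e'. e' \<in> M \<and> v \<in> e' \<and> e' \<subseteq> corners p"
  proof (cases "hedge i j \<in> M")
    case True
    then have "hedge i (j + 1) \<in> M" using alt by (auto simp: p alternating_square_def hmatch_def of_bool_def split: if_splits)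
    then show ?thesis using True e(3)
      by (intro exI[of _ "hedge i (snd v)"]) (auto simp: p corners_def hedge_def)
  next
    case False
    then have "vedge i j \<in> M" "vedge (i + 1) j \<in> M"
      using alt by (auto simp: p alternating_square_def hmatch_def vmatch_def of_bool_def split: if_splits)
    then show ?thesis using e(3)
      by (intro exI[of _ "vedge (fst v) j"]) (auto simp: p corners_def vedge_def)
  qed
  then show ?thesis using assms(3)[OF e(3)] e by blast
qed

section \<open>Perfect matchings and heights on a polyomino\<close>

context polyomino_graph
begin

lemma edges_grid: "edges H \<subseteq> edges square_grid" and edge_verts: "e \<in> edges H \<Longrightarrow> e \<subseteq> verts H"
  using sub by (auto simp: subgraph_def)

lemma corners_verts: "p \<in> face_squares \<Longrightarrow> corners p \<subseteq> verts H"
  using face_square_edges[of "fst p" "snd p"] edge_verts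
  by (cases p) (auto simp: corners_def hedge_def)

lemma finite_face_squares: "finite face_squares"
proof (rule finite_subset[OF _ fin])
  show "face_squares \<subseteq> verts H" using corners_verts by (force simp: corners_def)
qed

lemma face_verts_cell: "p \<in> face_squares \<Longrightarrow> face_verts H (cell p) = corners p"
proof -
  assume p: "p \<in> face_squares"
  obtain i j where ij: "p = (i, j)" by (cases p)
  have "point v \<in> frontier (cell p) \<longleftrightarrow> v \<in> corners p" for v
    by (cases v) (auto simp: ij frontier_cell mem_unit_square mem_cell corners_def)
  then show ?thesis using corners_verts[OF p] by (auto simp: face_verts_def)
qed

text \<open>With the value 0 off the graph, the difference of two matchings is divergence-free on
  the whole grid.\<close>

lemma matching_deg:
  assumes "perfect_matching H M"
  shows "deg (hmatch M) (vmatch M) i j = of_bool ((i, j) \<in> verts H)"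
proof (cases "(i, j) \<in> verts H")
  case True
  then show ?thesis using assms deg_eq_1_iff[of M i j] edges_grid by (auto simp: perfect_matching_def)
next
  case False
  then have "e \<notin> M" if "(i, j) \<in> e" for e using assms that edge_verts by (auto simp: perfect_matching_def)
  then show ?thesis using False by (simp add: deg_def hmatch_def vmatch_def mem_hedge mem_vedge)
qed

lemma matching_of_functions:
  assumes x: "\<And>i j. x i j \<in> {0, 1}" "\<And>i j. x i j = 1 \<Longrightarrow> hedge i j \<in> edges H"
    and y: "\<And>i j. y i j \<in> {0, 1}" "\<And>i j. y i j = 1 \<Longrightarrow> vedge i j \<in> edges H"
    and d: "\<And>i j. (i, j) \<in> verts H \<Longrightarrow> deg x y i j = 1"
  obtains N where "perfect_matching H N" "hmatch N = x" "vmatch N = y"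
proof -
  define N where "N = {hedge i j | i j. x i j = 1} \<union> {vedge i j | i j. y i j = 1}"
  have hx: "hmatch N = x"
  proof (intro ext)
    fix i j show "hmatch N i j = x i j" using x(1)[of i j] by (auto simp: hmatch_def N_def)
  qed
  have vy: "vmatch N = y"
  proof (intro ext)
    fix i j show "vmatch N i j = y i j" using y(1)[of i j] by (auto simp: vmatch_def N_def)
  qed
  have N: "N \<subseteq> edges H" using x y by (auto simp: N_def)
  moreover have "\<exists>!e. e \<in> N \<and> v \<in> e" if "v \<in> verts H" for v
    using d[of "fst v" "snd v"] that deg_eq_1_iff[of N "fst v" "snd v"] N edges_grid hx vy by auto
  ultimately have "perfect_matching H N" by (simp add: perfect_matching_def)
  then show thesis using that hx vy by blast
qed

lemma resonant_cell_iff: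
  assumes "(i, j) \<in> face_squares"
  shows "resonant_face H M (cell (i, j)) \<longleftrightarrow> alternating_square (hmatch M) (vmatch M) (i, j)"
proof
  assume "resonant_face H M (cell (i, j))"
  then show "alternating_square (hmatch M) (vmatch M) (i, j)"
    using alternating_square_cycle[OF _ sub] by (auto simp: resonant_face_def)
next
  assume al: "alternating_square (hmatch M) (vmatch M) (i, j)"
  define c where "c = [(i, j), (i + 1, j), (i + 1, j + 1), (i, j + 1)]"
  have ce: "cycle_edge c 0 = hedge i j" "cycle_edge c 1 = vedge (i + 1) j"
    "cycle_edge c 2 = hedge i (j + 1)" "cycle_edge c 3 = vedge i j" "cycle_edge c 4 = hedge i j"
    by (simp_all add: c_def cycle_edge_def hedge_def vedge_def insert_commute)
  have len: "length c = 4" by (simp add: c_def)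
  have lt4: "k < 4 \<longleftrightarrow> k = 0 \<or> k = 1 \<or> k = 2 \<or> k = 3" for k :: nat by linarith
  have "set c \<subseteq> verts H" using corners_verts[OF assms] by (auto simp: c_def corners_def)
  then have "is_cycle H c" unfolding is_cycle_def len lt4
    using face_square_edges[OF assms] ce by (auto simp: c_def)
  moreover have "\<forall>k<length c. cycle_edge c k \<in> M \<longleftrightarrow> cycle_edge c (Suc k) \<notin> M"
    unfolding len lt4 using al ce
    by (auto simp: alternating_square_def hmatch_def vmatch_def numeral_eq_Suc of_bool_def split: if_splits)
  moreover have "frontier (cell (i, j)) = (\<Union>k < length c. edge_segment (cycle_edge c k))"
  proof -
    have "{..<4::nat} = {0, 1, 2, 3}" by auto
    then show ?thesis by (simp only: len cell_frontier_union) (simp add: ce ce(2)[simplified] Un_assoc)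
  qed
  ultimately show "resonant_face H M (cell (i, j))" by (auto simp: resonant_face_def alternating_cycle_def)
qed

text \<open>The flow is divergence-free at vertices of degree 1, and \<open>potential_on\<close>
  applies because the face squares enclose no holes.\<close>

lemma height_function:
  assumes "perfect_matching H M"
  obtains h where
    "\<And>i j. (i, j) \<in> face_squares \<Longrightarrow> (i, j - 1) \<in> face_squares \<Longrightarrow> parity_sign i j * (4 * hmatch M i j - 1) = h i j - h i (j - 1)"
    "\<And>i j. (i, j) \<in> face_squares \<Longrightarrow> (i - 1, j) \<in> face_squares \<Longrightarrow> parity_sign i j * (4 * vmatch M i j - 1) = h (i - 1) j - h i j"
proof -
  define B where "B = Max (insert 0 ((\<lambda>(i, j). max \<bar>i\<bar> \<bar>j\<bar>) ` face_squares)) + 1"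
  have FB: "face_squares \<subseteq> {-B<..<B} \<times> {-B<..<B}"
  proof clarify
    fix i j assume "(i, j) \<in> face_squares"
    then have "max \<bar>i\<bar> \<bar>j\<bar> < B" unfolding B_def using finite_face_squares
      by (intro zle_add1_eq_le[THEN iffD2] Max_ge) (auto intro!: image_eqI[of _ _ "(i, j)"])
    then show "i \<in> {-B<..<B} \<and> j \<in> {-B<..<B}" by auto
  qed
  \<comment> \<open>A square of \<open>Q\<close> next to one outside \<open>Q\<close> is a face
    square, since otherwise it would be reachable. So the border of \<open>Q\<close> consists of
    edges of \<open>H\<close>, and all enclosed squares are faces.\<close>
  define Q where "Q = - outer face_squares B"
  have Qn: "q \<in> face_squares" if "q \<in> Q" "p \<notin> Q" "\<bar>fst p - fst q\<bar> + \<bar>snd p - snd q\<bar> = 1" for p q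
    using that outer.step[of "fst p" "snd p" face_squares B "fst q" "snd q"] by (auto simp: Q_def)
  have "Q \<subseteq> face_squares"
  proof (rule enclosed_squares_are_faces)
    have "face_squares \<subseteq> {-B..B} \<times> {-B..B}" using FB by fastforce
    then show "finite Q" unfolding Q_def by (rule finite_not_outer)
    show "hedge i j \<in> edges H" if "((i, j) \<in> Q) \<noteq> ((i, j - 1) \<in> Q)" for i j
    proof (cases "(i, j) \<in> Q")
      case True
      then have "(i, j) \<in> face_squares" using that Qn[of "(i, j)" "(i, j - 1)"] by simp
      then show ?thesis using face_square_edges by blast
    next
      case False
      then have "(i, j - 1) \<in> face_squares" using that Qn[of "(i, j - 1)" "(i, j)"] by simp
      then show ?thesis using face_square_edges[of i "j - 1"] by simp
    qed
    show "vedge i j \<in> edges H" if "((i, j) \<in> Q) \<noteq> ((i - 1, j) \<in> Q)" for i j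
    proof (cases "(i, j) \<in> Q")
      case True
      then have "(i, j) \<in> face_squares" using that Qn[of "(i, j)" "(i - 1, j)"] by simp
      then show ?thesis using face_square_edges by blast
    next
      case False
      then have "(i - 1, j) \<in> face_squares" using that Qn[of "(i - 1, j)" "(i, j)"] by simp
      then show ?thesis using face_square_edges[of "i - 1" j] by simp
    qed
  qed
  then have out: "- face_squares \<subseteq> outer face_squares B" by (auto simp: Q_def)
  show thesis
  proof (rule potential_on[OF FB out])
    fix i j assume "(i, j) \<in> face_squares"
    then have "(i, j) \<in> verts H" using corners_verts by (force simp: corners_def)
    then have "deg (hmatch M) (vmatch M) i j = 1" using matching_deg[OF assms] by simp
    then have "deg (\<lambda>i j. 4 * hmatch M i j - 1) (\<lambda>i j. 4 * vmatch M i j - 1) i j = 0"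
      by (simp add: deg_def)
    then show "divergence (\<lambda>i j. parity_sign i j * (4 * hmatch M i j - 1)) (\<lambda>i j. parity_sign i j * (4 * vmatch M i j - 1)) i j = 0"
      by (simp add: divergence_parity_sign)
  qed (use that in blast)
qed

lemma finite_matching_bound:
  obtains L where "\<And>M. perfect_matching H M \<Longrightarrow> bounded_flow (hmatch M) L" "\<And>M. perfect_matching H M \<Longrightarrow> bounded_flow (vmatch M) L"
proof -
  define L where "L = Max (insert 0 ((\<lambda>(i, j). max \<bar>i\<bar> \<bar>j\<bar>) ` verts H)) + 1"
  have L: "max \<bar>i\<bar> \<bar>j\<bar> < L" if "(i, j) \<in> verts H" for i j
    unfolding L_def using fin that
    by (intro zle_add1_eq_le[THEN iffD2] Max_ge) (auto intro!: image_eqI[of _ _ "(i, j)"])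
  have z: "hmatch M i j = 0 \<and> vmatch M i j = 0" if "perfect_matching H M" "\<bar>i\<bar> \<ge> L \<or> \<bar>j\<bar> \<ge> L" for M i j
  proof -
    have "(i, j) \<notin> verts H" using L[of i j] that(2) by auto
    then have "hedge i j \<notin> edges H" "vedge i j \<notin> edges H" using edge_verts by (auto simp: hedge_def vedge_def)
    then show ?thesis using that(1) by (auto simp: perfect_matching_def hmatch_def vmatch_def)
  qed
  show thesis by (rule that[of L]) (use z in \<open>auto simp: bounded_flow_def\<close>)
qed

text \<open>A positive value of \<open>w\<close> would yield, by
  \<open>larger_flippable_set\<close>, a resonant set larger than the maximum one.\<close>

lemma no_positive_winding:
  assumes K: "maximum_resonant_set H (cell ` S)" and S: "S \<subseteq> face_squares"
    and apartS: "\<And>p q. p \<in> S \<Longrightarrow> q \<in> S \<Longrightarrow> p \<noteq> q \<Longrightarrow> apart p q"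
    and M: "perfect_matching H M" "perfect_matching H M'"
    and altS: "\<And>p. p \<in> S \<Longrightarrow> alternating_square (hmatch M) (vmatch M) p"
    and agree: "\<And>p e. p \<in> S \<Longrightarrow> e \<inter> corners p \<noteq> {} \<Longrightarrow> e \<in> M \<longleftrightarrow> e \<in> M'"
    and wx: "\<And>i j. parity_sign i j * (hmatch M' i j - hmatch M i j) = w i j - w i (j - 1)"
    and wy: "\<And>i j. parity_sign i j * (vmatch M' i j - vmatch M i j) = w (i - 1) j - w i j"
    and finw: "finite {(i, j). w i j \<noteq> 0}"
  shows "w i j \<le> 0"
proof (rule ccontr)
  assume pos: "\<not> w i j \<le> 0"
  obtain h where h:
    "\<And>i j. (i, j) \<in> face_squares \<Longrightarrow> (i, j - 1) \<in> face_squares \<Longrightarrow> parity_sign i j * (4 * hmatch M i j - 1) = h i j - h i (j - 1)"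
    "\<And>i j. (i, j) \<in> face_squares \<Longrightarrow> (i - 1, j) \<in> face_squares \<Longrightarrow> parity_sign i j * (4 * vmatch M i j - 1) = h (i - 1) j - h i j"
    using height_function[OF M(1)] by metis
  have ME: "M \<subseteq> edges H" "M' \<subseteq> edges H" using M by (auto simp: perfect_matching_def)
  \<comment> \<open>Where \<open>w\<close> passes between zero and nonzero, the matchings differ, so
    the edge crossed belongs to \<open>H\<close>.\<close>
  have "{(i, j). w i j \<noteq> 0} \<subseteq> face_squares"
  proof (rule enclosed_squares_are_faces[OF finw])
    fix i j assume "((i, j) \<in> {(i, j). w i j \<noteq> 0}) \<noteq> ((i, j - 1) \<in> {(i, j). w i j \<noteq> 0})"
    then have "hmatch M i j \<noteq> hmatch M' i j" using wx[of i j] by auto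
    then show "hedge i j \<in> edges H" using ME by (auto simp: hmatch_def of_bool_def split: if_splits)
  next
    fix i j assume "((i, j) \<in> {(i, j). w i j \<noteq> 0}) \<noteq> ((i - 1, j) \<in> {(i, j). w i j \<noteq> 0})"
    then have "vmatch M i j \<noteq> vmatch M' i j" using wy[of i j] by auto
    then show "vedge i j \<in> edges H" using ME by (auto simp: vmatch_def of_bool_def split: if_splits)
  qed
  then have wF: "(i, j) \<in> face_squares" if "w i j \<ge> 1" for i j using that by auto
  \<comment> \<open>No edge at a corner of the square carries a difference, and crossing such edges
    reaches all eight surrounding squares.\<close>
  have block: "w (i + a) (j + b) = w i j" if p: "(i, j) \<in> S" and ab: "\<bar>a\<bar> \<le> 1" "\<bar>b\<bar> \<le> 1" for i j a b
  proof -
    have eh: "w k l = w k (l - 1)" if "(k, l) \<in> corners (i, j) \<or> (k + 1, l) \<in> corners (i, j)" for k l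
    proof -
      have "hedge k l \<in> M \<longleftrightarrow> hedge k l \<in> M'"
        by (rule agree[OF p]) (use that in \<open>auto simp: hedge_def\<close>)
      then show ?thesis using wx[of k l] by (simp add: hmatch_def)
    qed
    have ev: "w (k - 1) l = w k l" if "(k, l) \<in> corners (i, j) \<or> (k, l + 1) \<in> corners (i, j)" for k l
    proof -
      have "vedge k l \<in> M \<longleftrightarrow> vedge k l \<in> M'"
        by (rule agree[OF p]) (use that in \<open>auto simp: vedge_def\<close>)
      then show ?thesis using wy[of k l] by (simp add: vmatch_def)
    qed
    have mid: "w (i + a) j = w i j"
    proof -
      have "a = -1 \<or> a = 0 \<or> a = 1" using ab(1) by linarith
      then show ?thesis using ev[of i j] ev[of "i + 1" j] by (auto simp: corners_def)
    qed
    have "w k (j + b) = w k j" if "k \<in> {i - 1, i, i + 1}" for k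
    proof -
      have "b = -1 \<or> b = 0 \<or> b = 1" using ab(2) by linarith
      then show ?thesis
        using that eh[of k j] eh[of k "j + 1"] by (auto simp: corners_def)
    qed
    moreover have "i + a \<in> {i - 1, i, i + 1}" using ab(1) by auto
    ultimately show ?thesis using mid by metis
  qed
  interpret fs: flip_setup face_squares S "hmatch M" "vmatch M" "hmatch M'" "vmatch M'" w h
  proof
    show "deg (hmatch M) (vmatch M) i j = 1" if "p \<in> face_squares" "(i, j) \<in> corners p" for p i j
      using matching_deg[OF M(1)] corners_verts[OF that(1)] that(2) by auto
    show "\<exists>i j. w i j \<ge> 1" using pos by (intro exI[of _ i] exI[of _ j]) simp
  qed (use S apartS altS wx wy h finite_face_squares block wF in \<open>auto simp: hmatch_def vmatch_def\<close>)
  obtain \<tau> where \<tau>: "card (fs.flippable \<tau>) > card S" using fs.larger_flippable_set by blast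
  obtain N where N: "perfect_matching H N" "hmatch N = fs.nx \<tau>" "vmatch N = fs.ny \<tau>"
  proof (rule matching_of_functions[of "fs.nx \<tau>" "fs.ny \<tau>"])
    show "fs.nx \<tau> i j \<in> {0, 1}" "fs.ny \<tau> i j \<in> {0, 1}" for i j by (fact fs.nx01 fs.ny01)+
    show "hedge i j \<in> edges H" if "fs.nx \<tau> i j = 1" for i j
    proof (cases "hmatch M i j = 1")
      case True
      then show ?thesis using ME by (auto simp: hmatch_def of_bool_def split: if_splits)
    next
      case False
      \<comment> \<open>A newly matched edge is a side of a face square, hence an edge of
        \<open>H\<close>.\<close>
      then have "(i, j) \<in> face_squares \<or> (i, j - 1) \<in> face_squares" using fs.nx_change[of \<tau> i j] that by simp
      then show ?thesis using face_square_edges[of i j] face_square_edges[of i "j - 1"] by auto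
    qed
    show "vedge i j \<in> edges H" if "fs.ny \<tau> i j = 1" for i j
    proof (cases "vmatch M i j = 1")
      case True
      then show ?thesis using ME by (auto simp: vmatch_def of_bool_def split: if_splits)
    next
      case False
      then have "(i, j) \<in> face_squares \<or> (i - 1, j) \<in> face_squares" using fs.ny_change[of \<tau> i j] that by simp
      then show ?thesis using face_square_edges[of i j] face_square_edges[of "i - 1" j] by auto
    qed
    show "deg (fs.nx \<tau>) (fs.ny \<tau>) i j = 1" if "(i, j) \<in> verts H" for i j
      using fs.deg_n matching_deg[OF M(1)] that by simp
  qed
  have AF: "fs.flippable \<tau> \<subseteq> face_squares" by (rule fs.flippable_F)
  have "resonant_set H (cell ` fs.flippable \<tau>)"
    unfolding resonant_set_def
  proof (intro conjI exI[of _ N] ballI)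
    show "cell ` fs.flippable \<tau> \<subseteq> finite_faces H" using AF by (auto simp: face_squares_def)
    show "pairwise (\<lambda>f g. disjnt (face_verts H f) (face_verts H g)) (cell ` fs.flippable \<tau>)"
    proof (rule pairwiseI)
      fix f g assume "f \<in> cell ` fs.flippable \<tau>" "g \<in> cell ` fs.flippable \<tau>" "f \<noteq> g"
      then obtain p q where pq: "f = cell p" "g = cell q" "p \<in> fs.flippable \<tau>" "q \<in> fs.flippable \<tau>" "p \<noteq> q" by blast
      moreover have "p \<in> face_squares" "q \<in> face_squares" using pq AF by auto
      ultimately show "disjnt (face_verts H f) (face_verts H g)"
        using fs.flippable_apart[OF pq(3-5)] by (simp add: face_verts_cell corners_disjnt_iff)
    qed
    show "resonant_face H N f" if f: "f \<in> cell ` fs.flippable \<tau>" for f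
    proof -
      obtain p where p: "p \<in> fs.flippable \<tau>" "f = cell p" using f by blast
      then show ?thesis using fs.flippable_alt[OF p(1)] AF N resonant_cell_iff[of "fst p" "snd p" N] by auto
    qed
  qed (fact N)
  then have "card (cell ` fs.flippable \<tau>) \<le> card (cell ` S)" using K by (simp add: maximum_resonant_set_def)
  moreover have "inj cell" using inj_cell by (auto intro: injI)
  ultimately show False using \<tau> card_image[of cell] by (metis inj_on_subset subset_UNIV not_less)
qed

end

section \<open>Existence by restriction, uniqueness by a vanishing potential\<close>

theorem theorem2p1:
  fixes H :: "(int \<times> int) graph" and K :: "complex set set"
  assumes "polyomino H"
    and "\<exists>M. perfect_matching H M"
    and "maximum_resonant_set H K"
  shows "\<exists>!M. perfect_matching (delete_faces H K) M"
proof -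
  interpret polyomino_graph H by unfold_locales fact
  obtain M0 where M0: "perfect_matching H M0" and resM0: "\<And>f. f \<in> K \<Longrightarrow> resonant_face H M0 f"
    and KF: "K \<subseteq> finite_faces H" and dK: "pairwise (\<lambda>f g. disjnt (face_verts H f) (face_verts H g)) K"
    using assms(3) unfolding maximum_resonant_set_def resonant_set_def by blast
  define S where "S = {p. cell p \<in> K}"
  have SF: "S \<subseteq> face_squares" using KF by (auto simp: S_def face_squares_def)
  have KS: "K = cell ` S" using KF finite_face_cell by (fastforce simp: S_def)
  have apartS: "apart p q" if "p \<in> S" "q \<in> S" "p \<noteq> q" for p q
  proof -
    have "disjnt (face_verts H (cell p)) (face_verts H (cell q))"
      using dK that inj_cell[of p q] by (auto simp: pairwise_def S_def)
    moreover have "p \<in> face_squares" "q \<in> face_squares" using that SF by auto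
    ultimately show ?thesis by (simp add: face_verts_cell corners_disjnt_iff)
  qed
  have alt0: "alternating_square (hmatch M0) (vmatch M0) p" if "p \<in> S" for p
    using that resM0[of "cell p"] resonant_cell_iff[of "fst p" "snd p" M0] SF by (auto simp: S_def)
  define W where "W = (\<Union>p\<in>S. corners p)"
  have del: "delete_faces H K = delete_verts H W"
    using SF by (auto simp: delete_faces_def KS W_def face_verts_cell subset_iff intro!: arg_cong[of _ _ "delete_verts H"])
  have M0E: "M0 \<subseteq> edges H" "\<And>v. v \<in> verts H \<Longrightarrow> \<exists>!e. e \<in> M0 \<and> v \<in> e"
    using M0 by (auto simp: perfect_matching_def)
  \<comment> \<open>No edge of \<open>M0\<close> leaves \<open>W\<close>, so \<open>M0\<close>
    splits into matchings of \<open>W\<close> and of the rest.\<close>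
  have closedW: "e \<subseteq> W" if e: "e \<in> M0" "e \<inter> W \<noteq> {}" for e
  proof -
    obtain v p where vp: "v \<in> e" "v \<in> corners p" "p \<in> S" using e by (auto simp: W_def)
    have "corners p \<subseteq> verts H" using corners_verts SF vp(3) by blast
    then have "e \<subseteq> corners p"
      using alternating_edges_in_corners[OF _ alt0[OF vp(3)] _ e(1) vp(1,2)] M0E edges_grid by blast
    then show ?thesis using vp(3) by (auto simp: W_def)
  qed
  have WV: "W \<subseteq> verts H" using corners_verts SF by (auto simp: W_def)
  have "perfect_matching (delete_verts H W) {e \<in> M0. e \<inter> W = {}}"
    unfolding perfect_matching_def
  proof (intro conjI ballI)
    show "{e \<in> M0. e \<inter> W = {}} \<subseteq> edges (delete_verts H W)" using M0E by (auto simp: delete_verts_def)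
    fix v assume "v \<in> verts (delete_verts H W)"
    then have v: "v \<in> verts H" "v \<notin> W" by (auto simp: delete_verts_def)
    have "e \<in> {e \<in> M0. e \<inter> W = {}} \<and> v \<in> e \<longleftrightarrow> e \<in> M0 \<and> v \<in> e" for e using closedW[of e] v by auto
    then show "\<exists>!e. e \<in> {e \<in> M0. e \<inter> W = {}} \<and> v \<in> e" using M0E(2)[OF v(1)] by simp
  qed
  moreover have "M1 = M2" if M12: "perfect_matching (delete_verts H W) M1" "perfect_matching (delete_verts H W) M2" for M1 M2
  proof -
    \<comment> \<open>Extends a matching of the remainder by the edges of \<open>M0\<close> inside
      \<open>W\<close>.\<close>
    define X where "X M = M \<union> {e \<in> M0. e \<inter> W \<noteq> {}}" for M
    have MW: "e \<in> edges H" "e \<inter> W = {}" if "perfect_matching (delete_verts H W) M" "e \<in> M" for M e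
      using that by (auto simp: perfect_matching_def delete_verts_def)
    have XM0: "e \<in> X M \<longleftrightarrow> e \<in> M0" if "perfect_matching (delete_verts H W) M" "e \<inter> W \<noteq> {}" for M e
      using MW[OF that(1)] that(2) by (auto simp: X_def)
    have pX: "perfect_matching H (X M)" if M: "perfect_matching (delete_verts H W) M" for M
      unfolding perfect_matching_def
    proof (intro conjI ballI)
      show "X M \<subseteq> edges H" using MW[OF M] M0E by (auto simp: X_def)
      fix v assume v: "v \<in> verts H"
      show "\<exists>!e. e \<in> X M \<and> v \<in> e"
      proof (cases "v \<in> W")
        case True
        then have "e \<in> X M \<and> v \<in> e \<longleftrightarrow> e \<in> M0 \<and> v \<in> e" for e using XM0[OF M, of e] by auto
        then show ?thesis using M0E(2)[OF v] by simp
      next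
        case False
        then have "e \<in> X M \<and> v \<in> e \<longleftrightarrow> e \<in> M \<and> v \<in> e" for e using closedW[of e] by (auto simp: X_def)
        then show ?thesis using M v False by (simp add: perfect_matching_def delete_verts_def)
      qed
    qed
    have agree: "e \<in> X M \<longleftrightarrow> e \<in> M0" if "perfect_matching (delete_verts H W) M" "p \<in> S" "e \<inter> corners p \<noteq> {}" for M p e
      using XM0[OF that(1), of e] that(2,3) by (auto simp: W_def)
    have altX: "alternating_square (hmatch (X M)) (vmatch (X M)) p" if M: "perfect_matching (delete_verts H W) M" and p: "p \<in> S" for M p
    proof -
      obtain i j where ij: "p = (i, j)" by (cases p)
      have "hedge i j \<in> X M \<longleftrightarrow> hedge i j \<in> M0" "hedge i (j + 1) \<in> X M \<longleftrightarrow> hedge i (j + 1) \<in> M0"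
        "vedge i j \<in> X M \<longleftrightarrow> vedge i j \<in> M0" "vedge (i + 1) j \<in> X M \<longleftrightarrow> vedge (i + 1) j \<in> M0"
        by (rule agree[OF M p]; auto simp: ij corners_def hedge_def vedge_def)+
      then show ?thesis using alt0[OF p] by (simp add: ij alternating_square_def hmatch_def vmatch_def)
    qed
    let ?a = "\<lambda>i j. parity_sign i j * (hmatch (X M2) i j - hmatch (X M1) i j)"
    let ?b = "\<lambda>i j. parity_sign i j * (vmatch (X M2) i j - vmatch (X M1) i j)"
    obtain L where "\<And>M. perfect_matching H M \<Longrightarrow> bounded_flow (hmatch M) L" "\<And>M. perfect_matching H M \<Longrightarrow> bounded_flow (vmatch M) L"
      using finite_matching_bound by blast
    then have bf: "bounded_flow ?a L" "bounded_flow ?b L" using pX M12 by (auto simp: bounded_flow_def)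
    have "divergence ?a ?b i j = 0" for i j
    proof -
      have "divergence ?a ?b i j = parity_sign i j * deg (\<lambda>i j. hmatch (X M2) i j - hmatch (X M1) i j) (\<lambda>i j. vmatch (X M2) i j - vmatch (X M1) i j) i j"
        by (rule divergence_parity_sign)
      also have "deg (\<lambda>i j. hmatch (X M2) i j - hmatch (X M1) i j) (\<lambda>i j. vmatch (X M2) i j - vmatch (X M1) i j) i j =
          deg (hmatch (X M2)) (vmatch (X M2)) i j - deg (hmatch (X M1)) (vmatch (X M1)) i j" by (simp add: deg_def)
      finally show ?thesis using matching_deg pX M12 by simp
    qed
    then obtain w where w: "\<And>i j. ?a i j = w i j - w i (j - 1)" "\<And>i j. ?b i j = w (i - 1) j - w i j"
      "finite {(i, j). w i j \<noteq> 0}"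
      using finite_potential[OF bf(2,1)] by blast
    have K': "maximum_resonant_set H (cell ` S)" using assms(3) KS by simp
    have "w i j \<le> 0" for i j
      by (rule no_positive_winding[OF K' SF apartS pX[OF M12(1)] pX[OF M12(2)] altX[OF M12(1)] _ w])
        (use agree[OF M12(1)] agree[OF M12(2)] in auto)
    moreover have "- w i j \<le> 0" for i j
    \<comment> \<open>Exchanging the two matchings negates the potential.\<close>
    proof (rule no_positive_winding[where w = "\<lambda>i j. - w i j", OF K' SF apartS pX[OF M12(2)] pX[OF M12(1)] altX[OF M12(2)]])
      show "finite {(i, j). - w i j \<noteq> 0}" using w(3) by simp
      show "parity_sign i j * (hmatch (X M1) i j - hmatch (X M2) i j) = - w i j - - w i (j - 1)" for i j
        using w(1)[of i j] by (simp add: algebra_simps)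
      show "parity_sign i j * (vmatch (X M1) i j - vmatch (X M2) i j) = - w (i - 1) j - - w i j" for i j
        using w(2)[of i j] by (simp add: algebra_simps)
    qed (use agree[OF M12(1)] agree[OF M12(2)] in auto)
    ultimately have w0: "w i j = 0" for i j by (meson antisym neg_le_0_iff_le)
    have "hedge i j \<in> X M1 \<longleftrightarrow> hedge i j \<in> X M2" "vedge i j \<in> X M1 \<longleftrightarrow> vedge i j \<in> X M2" for i j
      using w(1)[of i j] w(2)[of i j] parity_sign_cases[of i j] by (auto simp: w0 hmatch_def vmatch_def)
    then have "e \<in> X M1 \<longleftrightarrow> e \<in> X M2" if "e \<in> edges square_grid" for e
      by (metis grid_edge_cases[OF that])
    moreover have "X M1 \<subseteq> edges square_grid" "X M2 \<subseteq> edges square_grid"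
      using pX[OF M12(1)] pX[OF M12(2)] edges_grid unfolding perfect_matching_def by blast+
    ultimately have "X M1 = X M2" by blast
    moreover have "M1 = {e \<in> X M1. e \<inter> W = {}}" "M2 = {e \<in> X M2. e \<inter> W = {}}"
      using MW(2)[OF M12(1)] MW(2)[OF M12(2)] unfolding X_def by blast+
    ultimately show "M1 = M2" by simp
  qed
  ultimately show ?thesis unfolding del by blast
qed

end
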